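(* Let $F_k:\mathbf{B}_n\to\mathbf{B}_N$ be a term in a Whitney sequence. Then $F_k\oplus 0$ is homotopic in target dimension $N+1$ to the injection $z\mapsto z\oplus 0$.
   Context: $\mathbf{B}_n$ denotes the open unit ball in $\mathbf{C}^n$. A holomorphic map between balls is proper if inverse images of compact sets are compact. $u\oplus 0=(u,0)$ denotes padding by zero components. Let $f:\mathbf{B}_n\to\mathbf{B}_{N_1}$ and $g:\mathbf{B}_n\to\mathbf{B}_{N_2}$ be proper holomorphic. They are homotopic in target dimension $M$ if there is a continuous function $H:\mathbf{B}_n\times[0,1]\to\mathbf{C}^M$, holomorphic in the first variable, such that for each $t\in[0,1]$ the map $H_t(z)=H(z,t)$ is a proper holomorphic map from $\mathbf{B}_n$ to $\mathbf{B}_M$, and $H_0\sim f\oplus 0$, $H_1\sim g\oplus 0$, where $\sim$ is norm equivalence: $u\sim v$ means $\|u(z)\|^2=\|v(z)\|^2$ for all $z$. A Whitney sequence is a sequence $F_0,F_1,\dots$ of rational proper maps $F_k:\mathbf{B}_n\to\mathbf{B}_{N_k}$ obtained as follows. $F_0=\phi_0$ is a holomorphic automorphism of $\mathbf{B}_n$ (so $N_0=n$). Given $F_k:\mathbf{B}_n\to\mathbf{B}_{N_k}$, choose a non-zero subspace $A_k$ of $\mathbf{C}^{N_k}$ with orthogonal projection $\pi_k$ onto $A_k$, a holomorphic automorphism $\phi_k$ of $\mathbf{B}_n$, and a linear norm-preserving injection $j_k$ into some $\mathbf{C}^{N_{k+1}}$, and put $$F_{k+1}=j_k\circ\big((\pi_kF_k\otimes\phi_k)\oplus(1-\pi_k)F_k\big),$$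 where $\pi_kF_k\otimes\phi_k$ takes values in $A_k\otimes\mathbf{C}^n$ and $(1-\pi_k)F_k$ in the orthogonal complement $A_k^\perp$ (with the standard Hermitian inner products). *)

theory Defs
  imports "HOL-Analysis.Analysis" "HOL-Library.Function_Algebras"
begin

text \<open>
  The dimension $n$ of the source ball is fixed, so $\mathbf{C}^n$ is the type \<open>complex ^ 'n\<close> and
  $\mathbf{B}_n$ is \<open>ball 0 1\<close>.  The target dimensions vary along a Whitney sequence, so target
  spaces are carrier sets: for a finite index set \<open>I\<close>, the space $\mathbf{C}^I$ consists of the
  functions \<open>'i \<Rightarrow> complex\<close> that vanish off \<open>I\<close>.  In particular $\mathbf{C}^N$ is
  \<open>vecs {..<N}\<close>, the tensor product $\mathbf{C}^N \otimes \mathbf{C}^n$ is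
  \<open>vecs ({..<N} \<times> UNIV)\<close>, and direct sums have the disjoint union \<open>I <+> J\<close> as index set.
  On such a carrier the topology of pointwise convergence, which the function type carries,
  is the Euclidean one.
\<close>

definition vecs :: "'i set \<Rightarrow> ('i \<Rightarrow> complex) set" where
  "vecs I = {x. \<forall>i. i \<notin> I \<longrightarrow> x i = 0}"

definition vscale :: "complex \<Rightarrow> ('i \<Rightarrow> complex) \<Rightarrow> 'i \<Rightarrow> complex" where
  "vscale c x = (\<lambda>i. c * x i)"

interpretation cvec: vector_space "vscale :: complex \<Rightarrow> ('i \<Rightarrow> complex) \<Rightarrow> 'i \<Rightarrow> complex"
  by unfold_locales (auto simp: vscale_def fun_eq_iff algebra_simps)

definition vinner :: "'i set \<Rightarrow> ('i \<Rightarrow> complex) \<Rightarrow> ('i \<Rightarrow> complex) \<Rightarrow> complex" where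
  "vinner I x y = (\<Sum>i\<in>I. x i * cnj (y i))"

definition vnorm :: "'i set \<Rightarrow> ('i \<Rightarrow> complex) \<Rightarrow> real" where
  "vnorm I x = L2_set (\<lambda>i. cmod (x i)) I"

definition vball :: "nat \<Rightarrow> (nat \<Rightarrow> complex) set" where
  "vball N = {x \<in> vecs {..<N}. vnorm {..<N} x < 1}"

text \<open>
  The coordinates of a point of \<open>complex ^ 'n\<close>, listed along an arbitrary but fixed enumeration
  of the index type: this identifies \<open>complex ^ 'n\<close> with $\mathbf{C}^n$ for \<open>n = CARD('n)\<close>.
\<close>

definition coords :: "complex ^ 'n \<Rightarrow> nat \<Rightarrow> complex" where
  "coords z = (\<lambda>i. if i < CARD('n) then z $ from_nat_into (UNIV :: 'n set) i else 0)"

text \<open>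
  The padding $u \mapsto u \oplus 0$ from $\mathbf{C}^N$ into any $\mathbf{C}^M$ with \<open>N \<le> M\<close>.
  Since vectors are already extended by zero, it is the identity on \<open>vecs {..<N}\<close>.
\<close>

definition pad :: "nat \<Rightarrow> (nat \<Rightarrow> complex) \<Rightarrow> nat \<Rightarrow> complex" where
  "pad N u = (\<lambda>i. if i < N then u i else 0)"

text \<open>Complex Frechet differentiability; the second conjunct makes the derivative complex linear.\<close>

definition holo_on :: "(complex ^ 'n) set \<Rightarrow> (complex ^ 'n \<Rightarrow> complex) \<Rightarrow> bool" where
  "holo_on S f \<longleftrightarrow>
     (\<forall>z\<in>S. \<exists>D. (f has_derivative D) (at z) \<and> (\<forall>c v. D (c *s v) = c * D v))"

definition ball_automorphism :: "(complex ^ 'n \<Rightarrow> complex ^ 'n) \<Rightarrow> bool" where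
  "ball_automorphism \<phi> \<longleftrightarrow>
     bij_betw \<phi> (ball 0 1) (ball 0 1) \<and>
     (\<forall>i. holo_on (ball 0 1) (\<lambda>z. \<phi> z $ i)) \<and>
     (\<forall>i. holo_on (ball 0 1) (\<lambda>z. the_inv_into (ball 0 1) \<phi> z $ i))"

definition proper_holo :: "nat \<Rightarrow> (complex ^ 'n \<Rightarrow> nat \<Rightarrow> complex) \<Rightarrow> bool" where
  "proper_holo N f \<longleftrightarrow>
     f ` ball 0 1 \<subseteq> vball N \<and>
     (\<forall>i<N. holo_on (ball 0 1) (\<lambda>z. f z i)) \<and>
     (\<forall>K. compact K \<and> K \<subseteq> vball N \<longrightarrow> compact {z \<in> ball 0 1. f z \<in> K})"

definition norm_equiv ::
    "nat \<Rightarrow> (complex ^ 'n \<Rightarrow> nat \<Rightarrow> complex) \<Rightarrow> (complex ^ 'n \<Rightarrow> nat \<Rightarrow> complex) \<Rightarrow> bool" where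
  "norm_equiv M u v \<longleftrightarrow>
     (\<forall>z\<in>ball 0 1. (vnorm {..<M} (u z))\<^sup>2 = (vnorm {..<M} (v z))\<^sup>2)"

text \<open>
  \<open>homotopic_in_dim M N1 f N2 g\<close>: the proper holomorphic maps $f$ and $g$, from $\mathbf{B}_n$ to
  the balls of dimensions \<open>N1\<close> and \<open>N2\<close>, are homotopic in target dimension \<open>M\<close>.
\<close>

definition homotopic_in_dim ::
    "nat \<Rightarrow> nat \<Rightarrow> (complex ^ 'n \<Rightarrow> nat \<Rightarrow> complex) \<Rightarrow>
     nat \<Rightarrow> (complex ^ 'n \<Rightarrow> nat \<Rightarrow> complex) \<Rightarrow> bool" where
  "homotopic_in_dim M N1 f N2 g \<longleftrightarrow>
     proper_holo N1 f \<and> proper_holo N2 g \<and> N1 \<le> M \<and> N2 \<le> M \<and>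
     (\<exists>H :: (complex ^ 'n) \<times> real \<Rightarrow> nat \<Rightarrow> complex.
        continuous_on (ball 0 1 \<times> {0..1}) H \<and>
        (\<forall>t\<in>{0..1}. proper_holo M (\<lambda>z. H (z, t))) \<and>
        norm_equiv M (\<lambda>z. H (z, 0)) (\<lambda>z. pad N1 (f z)) \<and>
        norm_equiv M (\<lambda>z. H (z, 1)) (\<lambda>z. pad N2 (g z)))"

definition orth_compl :: "nat \<Rightarrow> (nat \<Rightarrow> complex) set \<Rightarrow> (nat \<Rightarrow> complex) set" where
  "orth_compl N A = {y \<in> vecs {..<N}. \<forall>x\<in>A. vinner {..<N} y x = 0}"

definition is_orth_proj ::
    "nat \<Rightarrow> (nat \<Rightarrow> complex) set \<Rightarrow> ((nat \<Rightarrow> complex) \<Rightarrow> nat \<Rightarrow> complex) \<Rightarrow> bool" where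
  "is_orth_proj N A \<pi> \<longleftrightarrow> (\<forall>x\<in>vecs {..<N}. \<pi> x \<in> A \<and> x - \<pi> x \<in> orth_compl N A)"

definition tensor :: "(nat \<Rightarrow> complex) \<Rightarrow> complex ^ 'n \<Rightarrow> nat \<times> 'n \<Rightarrow> complex" where
  "tensor u v = (\<lambda>(i, l). u i * v $ l)"

definition dsum :: "('i \<Rightarrow> complex) \<Rightarrow> ('j \<Rightarrow> complex) \<Rightarrow> 'i + 'j \<Rightarrow> complex" where
  "dsum u v = case_sum u v"

text \<open>The subspace $A \otimes \mathbf{C}^n$ of $\mathbf{C}^N \otimes \mathbf{C}^n$.\<close>

definition tensor_space :: "(nat \<Rightarrow> complex) set \<Rightarrow> (nat \<times> 'n::finite \<Rightarrow> complex) set" where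
  "tensor_space A = cvec.span {tensor a v | a v. a \<in> A}"

text \<open>Linear norm-preserving injections from a subspace \<open>W\<close> of $\mathbf{C}^I$ into $\mathbf{C}^J$.\<close>

definition linear_isometry_on ::
    "('i \<Rightarrow> complex) set \<Rightarrow> 'i set \<Rightarrow> 'j set \<Rightarrow> (('i \<Rightarrow> complex) \<Rightarrow> 'j \<Rightarrow> complex) \<Rightarrow> bool" where
  "linear_isometry_on W I J j \<longleftrightarrow>
     j ` W \<subseteq> vecs J \<and>
     (\<forall>x\<in>W. \<forall>y\<in>W. j (x + y) = j x + j y) \<and>
     (\<forall>c. \<forall>x\<in>W. j (vscale c x) = vscale c (j x)) \<and>
     (\<forall>x\<in>W. vnorm J (j x) = vnorm I x) \<and>
     inj_on j W"

definition whitney_step ::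
    "nat \<Rightarrow> (complex ^ 'n \<Rightarrow> nat \<Rightarrow> complex) \<Rightarrow>
     nat \<Rightarrow> (complex ^ 'n \<Rightarrow> nat \<Rightarrow> complex) \<Rightarrow> bool" where
  "whitney_step N F N' F' \<longleftrightarrow>
     (\<exists>A \<pi> \<phi> j.
        A \<subseteq> vecs {..<N} \<and> cvec.subspace A \<and> A \<noteq> {0} \<and>
        is_orth_proj N A \<pi> \<and>
        ball_automorphism \<phi> \<and>
        linear_isometry_on {dsum T w | T w. T \<in> tensor_space A \<and> w \<in> orth_compl N A}
          (({..<N} \<times> (UNIV :: 'n set)) <+> {..<N}) {..<N'} j \<and>
        (\<forall>z\<in>ball 0 1. F' z = j (dsum (tensor (\<pi> (F z)) (\<phi> z)) (F z - \<pi> (F z)))))"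

definition whitney_sequence ::
    "(nat \<Rightarrow> nat) \<Rightarrow> (nat \<Rightarrow> complex ^ 'n \<Rightarrow> nat \<Rightarrow> complex) \<Rightarrow> bool" where
  "whitney_sequence N F \<longleftrightarrow>
     N 0 = CARD('n) \<and>
     (\<exists>\<phi>. ball_automorphism \<phi> \<and> (\<forall>z\<in>ball 0 1. F 0 z = coords (\<phi> z))) \<and>
     (\<forall>k. whitney_step (N k) (F k) (N (Suc k)) (F (Suc k)))"

end

theory Submission
  imports Defs "HOL-Complex_Analysis.Conformal_Mappings"
begin

text \<open>
  All maps are controlled through their Gram kernels \<open>\<langle>f z, f w\<rangle>\<close>.  Two proper maps into the same ball with
  equal Gram kernels are homotopic: complex reflections move finitely many spanning values of one onto
  those of the other.  Hence homotopies can be concatenated when only the kernels of their ends agree,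
  and the isometries in a Whitney sequence become irrelevant.  In an orthonormal basis adapted to \<open>A\<close>,
  a Whitney step multiplies some of the coordinates \<open>u\<close> of \<open>F\<close> by \<open>\<phi>\<close>.  Replacing one product
  \<open>u \<phi>\<close> by \<open>sqrt m u \<phi> \<oplus> sqrt (1 - m) u\<close> and letting \<open>m\<close> run from 1 to 0 undoes the step one
  coordinate at a time, each time in one more dimension than the larger of the two maps needs.  This
  leaves the automorphism \<open>F 0\<close>: by the Schwarz lemma it is a unitary map followed by an involution of
  the ball exchanging 0 and some point \<open>a\<close>, and it is deformed by moving \<open>a\<close> to 0.
\<close>

subsection \<open>Hermitian forms and holomorphic functions\<close>

text \<open>The extra dimension comes from a count. A coordinate that carries the factor
  \<open>\<phi>\<close> fills n components, one that does not fills a single component, and one in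
  transit fills n + 1. Undoing all of \<open>A\<close> simultaneously would cost dim A extra
  dimensions; one coordinate at a time costs one. The ambient dimension of the latest term then
  serves all earlier ones, because target dimensions never decrease: the tensor part and the
  complement together have dimension at least N, and \<open>j\<close> carries an orthonormal basis
  of their sum to an orthonormal system in the next target. The obstacle is joining the pieces:
  consecutive homotopies meet in maps that agree only up to a unitary change of coordinates, while
  concatenation needs equality. The Gram kernel records a map up to exactly this ambiguity, and the
  path that removes it stays in the same target dimension. At the very ends only norm equivalence is
  asked for, which is the diagonal of the kernel. Properness, too, depends on a holomorphic map only
  through its norm, so each intermediate map is tested by a formula for its norm.\<close>

lemma sum_fun_apply: "(\<Sum>a\<in>A. f a) x = (\<Sum>a\<in>A. f a x)"
  for f :: "'a \<Rightarrow> 'b \<Rightarrow> 'c::comm_monoid_add"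
  by (induction A rule: infinite_finite_induct) auto

lemma vnorm_sq: "(vnorm I x)\<^sup>2 = (\<Sum>i\<in>I. (cmod (x i))\<^sup>2)"
  by (simp add: vnorm_def L2_set_def sum_nonneg)

lemma vnorm_nonneg [simp]: "0 \<le> vnorm I x"
  by (simp add: vnorm_def)

lemma vinner_self: "vinner I x x = of_real ((vnorm I x)\<^sup>2)"
  by (simp add: vnorm_sq vinner_def complex_norm_square del: of_real_power)

lemma vinner_commute: "vinner I y x = cnj (vinner I x y)"
  by (simp add: vinner_def mult.commute)

lemma vinner_linear:
  "vinner I (x + y) z = vinner I x z + vinner I y z"
  "vinner I z (x + y) = vinner I z x + vinner I z y"
  "vinner I (x - y) z = vinner I x z - vinner I y z"
  "vinner I z (x - y) = vinner I z x - vinner I z y"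
  "vinner I (vscale c x) z = c * vinner I x z"
  "vinner I z (vscale c x) = cnj c * vinner I z x"
  "vinner I 0 z = 0" "vinner I z 0 = 0"
  by (simp_all add: vinner_def vscale_def sum.distrib sum_subtractf sum_distrib_left algebra_simps)

lemma vinner_sum:
  "vinner I (\<Sum>a\<in>A. f a) z = (\<Sum>a\<in>A. vinner I (f a) z)"
  "vinner I z (\<Sum>a\<in>A. f a) = (\<Sum>a\<in>A. vinner I z (f a))"
  by (induction A rule: infinite_finite_induct) (simp_all add: vinner_linear)

lemma vinner_eq_zeroD:
  assumes "finite I" "vinner I x x = 0" "x \<in> vecs I"
  shows "x = 0"
proof
  fix i
  have "\<forall>i\<in>I. (cmod (x i))\<^sup>2 = 0"
    using assms(1,2) unfolding vinner_self vnorm_sq of_real_eq_0_iff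
    by (subst (asm) sum_nonneg_eq_0_iff) auto
  then show "x i = 0 i" using assms(3) by (cases "i \<in> I") (auto simp: vecs_def)
qed

lemma vecs_closed:
  "0 \<in> vecs I"
  "x \<in> vecs I \<Longrightarrow> y \<in> vecs I \<Longrightarrow> x + y \<in> vecs I"
  "x \<in> vecs I \<Longrightarrow> y \<in> vecs I \<Longrightarrow> x - y \<in> vecs I"
  "x \<in> vecs I \<Longrightarrow> vscale c x \<in> vecs I"
  by (auto simp: vecs_def vscale_def)

lemma vecs_sum: "(\<And>a. a \<in> A \<Longrightarrow> f a \<in> vecs I) \<Longrightarrow> (\<Sum>a\<in>A. f a) \<in> vecs I"
  by (auto simp: vecs_def sum_fun_apply)

lemma vinner_Cauchy_Schwarz: "cmod (vinner I x y) \<le> vnorm I x * vnorm I y"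
proof -
  have "cmod (vinner I x y) \<le> (\<Sum>i\<in>I. cmod (x i) * cmod (y i))"
    unfolding vinner_def by (rule order_trans[OF norm_sum]) (simp add: norm_mult)
  also have "\<dots> \<le> vnorm I x * vnorm I y"
    using L2_set_mult_ineq[of "\<lambda>i. cmod (x i)" "\<lambda>i. cmod (y i)" I] by (simp add: vnorm_def)
  finally show ?thesis .
qed

lemma norm_eq_vnorm: "norm z = vnorm UNIV (($) z)" for z :: "complex ^ 'n"
  by (simp add: norm_vec_def vnorm_def)

section \<open>Complex differentiability in several variables\<close>

lemma holo_on_const: "holo_on S (\<lambda>z. c)"
  unfolding holo_on_def by (auto intro!: exI[of _ "\<lambda>_. 0"] derivative_eq_intros)

lemma holo_on_component: "holo_on S (\<lambda>z. z $ i)"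
  unfolding holo_on_def
  by (auto intro!: exI[of _ "\<lambda>v. v $ i"] bounded_linear_imp_has_derivative bounded_linear_vec_nth)

lemma holo_on_add:
  assumes "holo_on S f" "holo_on S g"
  shows "holo_on S (\<lambda>z. f z + g z)"
  unfolding holo_on_def
proof
  fix z assume "z \<in> S"
  then obtain D E where "(f has_derivative D) (at z)" "\<forall>c v. D (c *s v) = c * D v"
    "(g has_derivative E) (at z)" "\<forall>c v. E (c *s v) = c * E v"
    using assms unfolding holo_on_def by blast
  then show "\<exists>D. ((\<lambda>z. f z + g z) has_derivative D) (at z) \<and> (\<forall>c v. D (c *s v) = c * D v)"
    by (intro exI[of _ "\<lambda>v. D v + E v"]) (auto intro: has_derivative_add simp: algebra_simps)
qed

lemma holo_on_mult:
  assumes "holo_on S f" "holo_on S g"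
  shows "holo_on S (\<lambda>z. f z * g z)"
  unfolding holo_on_def
proof
  fix z assume "z \<in> S"
  then obtain D E where "(f has_derivative D) (at z)" "\<forall>c v. D (c *s v) = c * D v"
    "(g has_derivative E) (at z)" "\<forall>c v. E (c *s v) = c * E v"
    using assms unfolding holo_on_def by blast
  note DE = this
  show "\<exists>D. ((\<lambda>z. f z * g z) has_derivative D) (at z) \<and> (\<forall>c v. D (c *s v) = c * D v)"
    using DE(2,4) has_derivative_mult[OF DE(1,3)]
    by (intro exI[of _ "\<lambda>v. f z * E v + D v * g z"]) (auto simp: algebra_simps)
qed

lemma holo_on_minus: "holo_on S f \<Longrightarrow> holo_on S (\<lambda>z. - f z)"
  using holo_on_mult[OF holo_on_const[of S "-1"]] by fastforce

lemma holo_on_diff: "holo_on S f \<Longrightarrow> holo_on S g \<Longrightarrow> holo_on S (\<lambda>z. f z - g z)"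
  using holo_on_add[OF _ holo_on_minus] by fastforce

lemma holo_on_inverse:
  assumes "holo_on S f" "\<And>z. z \<in> S \<Longrightarrow> f z \<noteq> 0"
  shows "holo_on S (\<lambda>z. inverse (f z))"
  unfolding holo_on_def
proof
  fix z assume z: "z \<in> S"
  then obtain D where "(f has_derivative D) (at z)" "\<forall>c v. D (c *s v) = c * D v"
    using assms unfolding holo_on_def by blast
  then show "\<exists>D. ((\<lambda>z. inverse (f z)) has_derivative D) (at z) \<and> (\<forall>c v. D (c *s v) = c * D v)"
    using assms(2)[OF z]
    by (intro exI[of _ "\<lambda>v. - (inverse (f z) * D v * inverse (f z))"]) (auto intro: has_derivative_inverse)
qed

lemma holo_on_divide:
  "holo_on S f \<Longrightarrow> holo_on S g \<Longrightarrow> (\<And>z. z \<in> S \<Longrightarrow> g z \<noteq> 0) \<Longrightarrow> holo_on S (\<lambda>z. f z / g z)"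
  unfolding divide_inverse by (intro holo_on_mult holo_on_inverse)

lemma holo_on_sum:
  "(\<And>a. a \<in> A \<Longrightarrow> holo_on S (f a)) \<Longrightarrow> holo_on S (\<lambda>z. \<Sum>a\<in>A. f a z)"
  by (induction A rule: infinite_finite_induct) (auto intro: holo_on_const holo_on_add)

lemmas holo_on_intros =
  holo_on_const holo_on_component holo_on_add holo_on_mult holo_on_minus holo_on_diff
  holo_on_divide holo_on_sum

lemma holo_on_cong:
  assumes "open S" "\<And>z. z \<in> S \<Longrightarrow> f z = g z"
  shows "holo_on S f \<longleftrightarrow> holo_on S g"
  unfolding holo_on_def using assms
  by (metis (no_types, lifting) has_derivative_transform_within_open)

lemma holo_on_imp_continuous_on: "holo_on S f \<Longrightarrow> continuous_on S f"
  unfolding holo_on_def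
  by (meson continuous_at_imp_continuous_on has_derivative_continuous)

lemma holo_on_derivative_vec:
  fixes f :: "complex ^ 'n \<Rightarrow> complex ^ 'm"
  assumes "\<And>i. holo_on S (\<lambda>z. f z $ i)" "z \<in> S"
  obtains D where "(f has_derivative D) (at z)" "\<And>c v. D (c *s v) = c *s D v"
proof -
  have "\<forall>i. \<exists>D. ((\<lambda>z. f z $ i) has_derivative D) (at z) \<and> (\<forall>c v. D (c *s v) = c * D v)"
    using assms unfolding holo_on_def by blast
  then obtain D where D: "\<And>i. ((\<lambda>z. f z $ i) has_derivative D i) (at z)"
    "\<And>i c v. D i (c *s v) = c * D i v" by metis
  have "(f has_derivative (\<lambda>v. \<chi> i. D i v)) (at z)"
  proof (subst has_derivative_componentwise_within, intro ballI)
    fix b :: "complex ^ 'm" assume "b \<in> Basis"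
    then obtain i c where b: "b = axis i c" by (auto simp: Basis_vec_def)
    show "((\<lambda>x. f x \<bullet> b) has_derivative (\<lambda>x. (\<chi> i. D i x) \<bullet> b)) (at z)"
      unfolding b inner_axis by (auto intro!: derivative_eq_intros D)
  qed
  with D(2) show thesis by (intro that) (auto simp: vec_eq_iff)
qed

lemma holo_on_compose:
  fixes f :: "complex ^ 'n \<Rightarrow> complex ^ 'm"
  assumes "\<And>i. holo_on S (\<lambda>z. f z $ i)" "holo_on T g" "f ` S \<subseteq> T"
  shows "holo_on S (\<lambda>z. g (f z))"
  unfolding holo_on_def
proof
  fix z assume z: "z \<in> S"
  obtain D where D: "(f has_derivative D) (at z)" "\<And>c v. D (c *s v) = c *s D v"
    using holo_on_derivative_vec[of S f z] assms(1) z by blast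
  obtain E where E: "(g has_derivative E) (at (f z))" "\<And>c v. E (c *s v) = c * E v"
    using assms z unfolding holo_on_def by blast
  show "\<exists>D. ((\<lambda>z. g (f z)) has_derivative D) (at z) \<and> (\<forall>c v. D (c *s v) = c * D v)"
    using has_derivative_compose[OF D(1) E(1)] D(2) E(2)
    by (intro exI[of _ "\<lambda>v. E (D v)"]) auto
qed

lemma bounded_linear_vector_scalar: "bounded_linear (\<lambda>c. c *s u)" for u :: "complex ^ 'n"
proof (rule linear_conv_bounded_linear[THEN iffD1], rule linearI)
qed (auto simp: vec_eq_iff algebra_simps)

lemma holo_on_line:
  fixes f :: "complex ^ 'n \<Rightarrow> complex"
  assumes "holo_on S f" "\<zeta> *s u \<in> S" "(f has_derivative D) (at (\<zeta> *s u))"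
  shows "((\<lambda>\<zeta>. f (\<zeta> *s u)) has_field_derivative D u) (at \<zeta>)"
proof -
  obtain E where E: "(f has_derivative E) (at (\<zeta> *s u))" "\<And>c v. E (c *s v) = c * E v"
    using assms unfolding holo_on_def by blast
  \<comment> \<open>The given \<open>D\<close> is a priori only real linear; uniqueness of the
    derivative identifies it with the complex linear one.\<close>
  have "D = E" using assms(3) E(1) by (rule has_derivative_unique)
  have "((\<lambda>\<zeta>. \<zeta> *s u) has_derivative (\<lambda>\<zeta>. \<zeta> *s u)) (at \<zeta>)"
    by (rule bounded_linear_imp_has_derivative[OF bounded_linear_vector_scalar])
  from has_derivative_compose[OF this E(1)]
  show ?thesis unfolding has_field_derivative_def \<open>D = E\<close>
    by (rule has_derivative_eq_rhs) (auto simp: E(2) mult.commute)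
qed

subsection \<open>Proper maps and their homotopies\<close>

definition proper_on :: "'i set \<Rightarrow> (complex ^ 'n \<Rightarrow> 'i \<Rightarrow> complex) \<Rightarrow> bool" where
  "proper_on I f \<longleftrightarrow>
     (\<forall>i\<in>I. holo_on (ball 0 1) (\<lambda>z. f z i)) \<and>
     (\<forall>z\<in>ball 0 1. (vnorm I (f z))\<^sup>2 < 1) \<and>
     (\<forall>e>0. \<exists>r<1. \<forall>z\<in>ball 0 1. r < norm z \<longrightarrow> 1 - e < (vnorm I (f z))\<^sup>2)"

text \<open>The topology is pointwise convergence, so compactness comes from Tychonoff: the set is
  closed inside a product of discs, with the point 0 as factor at the indices beyond
  \<open>N\<close>.\<close>

lemma compact_vecs_norm_le:
  fixes N :: nat
  shows "compact {x \<in> vecs {..<N}. (vnorm {..<N} x)\<^sup>2 \<le> r}"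
proof -
  \<comment> \<open>The absolute value covers negative \<open>r\<close>, for which the set is
    empty.\<close>
  define P where "P = Pi\<^sub>E (UNIV :: nat set) (\<lambda>i. if i < N then cball (0::complex) (sqrt \<bar>r\<bar>) else {0})"
  have "compactin (product_topology (\<lambda>i. euclidean) UNIV) P"
    unfolding P_def compactin_PiE by auto
  then have "compact P" by (simp add: euclidean_product_topology)
  moreover have "continuous_on UNIV (\<lambda>x :: nat \<Rightarrow> complex. (vnorm {..<N} x)\<^sup>2)"
    unfolding vnorm_sq by (intro continuous_intros continuous_on_product_coordinates)
  then have "closed {x :: nat \<Rightarrow> complex. (vnorm {..<N} x)\<^sup>2 \<le> r}"
    by (intro closed_Collect_le) auto
  moreover have "{x \<in> vecs {..<N}. (vnorm {..<N} x)\<^sup>2 \<le> r} = P \<inter> {x. (vnorm {..<N} x)\<^sup>2 \<le> r}"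
  proof (intro equalityI subsetI)
    fix x assume x: "x \<in> {x \<in> vecs {..<N}. (vnorm {..<N} x)\<^sup>2 \<le> r}"
    have "cmod (x i) \<le> sqrt \<bar>r\<bar>" if "i < N" for i
    proof -
      have "(cmod (x i))\<^sup>2 \<le> (vnorm {..<N} x)\<^sup>2"
        unfolding vnorm_sq using that by (intro member_le_sum) auto
      also have "\<dots> \<le> \<bar>r\<bar>" using x by auto
      finally show ?thesis by (rule real_le_rsqrt)
    qed
    with x show "x \<in> P \<inter> {x. (vnorm {..<N} x)\<^sup>2 \<le> r}"
      by (auto simp: P_def vecs_def)
  qed (auto simp: P_def vecs_def PiE_iff split: if_splits)
  ultimately show ?thesis by (simp add: compact_Int_closed)
qed

lemma proper_on_properD:
  assumes "proper_on I f" "e > 0"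
  obtains r where "r < 1" "\<And>z. z \<in> ball 0 1 \<Longrightarrow> r < norm z \<Longrightarrow> 1 - e < (vnorm I (f z))\<^sup>2"
  using assms unfolding proper_on_def by blast

text \<open>Pulling back the closed ball of squared radius 1 - e gives a compact set, and its
  largest norm is the required r. Conversely, a compact K in the open ball has a largest norm below
  1, so the points sent to K stay away from the sphere.\<close>

lemma proper_holo_iff:
  "proper_holo N f \<longleftrightarrow> (\<forall>z\<in>ball 0 1. f z \<in> vecs {..<N}) \<and> proper_on {..<N} f"
proof
  assume P: "proper_holo N f"
  have mem: "f z \<in> vecs {..<N}" and lt: "(vnorm {..<N} (f z))\<^sup>2 < 1" if "z \<in> ball 0 1" for z
    using P that by (simp_all add: proper_holo_def image_subset_iff vball_def abs_square_less_1)
  have "\<exists>r<1. \<forall>z\<in>ball 0 1. r < norm z \<longrightarrow> 1 - e < (vnorm {..<N} (f z))\<^sup>2" if "e > 0" for e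
  proof -
    let ?K = "{x \<in> vecs {..<N}. (vnorm {..<N} x)\<^sup>2 \<le> 1 - e}"
    have "x \<in> vball N" if "x \<in> ?K" for x
    proof -
      have "(vnorm {..<N} x)\<^sup>2 < 1" using that \<open>e > 0\<close> by auto
      then show ?thesis using that by (simp add: vball_def abs_square_less_1)
    qed
    then have C: "compact {z \<in> ball 0 1. f z \<in> ?K}" (is "compact ?C")
      using P compact_vecs_norm_le[of N "1 - e"] unfolding proper_holo_def by blast
    show ?thesis
    proof (cases "?C = {}")
      case True
      have "1 - e < (vnorm {..<N} (f z))\<^sup>2" if "z \<in> ball 0 1" for z
        using True mem[OF that] that by force
      then show ?thesis by (intro exI[of _ 0]) auto
    next
      case False
      then obtain w where w: "w \<in> ?C" "\<And>z. z \<in> ?C \<Longrightarrow> norm z \<le> norm w"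
        using continuous_attains_sup[OF C False, of norm] by (auto intro: continuous_intros)
      have "1 - e < (vnorm {..<N} (f z))\<^sup>2" if "z \<in> ball 0 1" "norm w < norm z" for z
        using w(2)[of z] that mem[of z] by force
      then show ?thesis using w(1) by (intro exI[of _ "norm w"]) auto
    qed
  qed
  then show "(\<forall>z\<in>ball 0 1. f z \<in> vecs {..<N}) \<and> proper_on {..<N} f"
    using P mem lt by (auto simp: proper_on_def proper_holo_def)
next
  assume P: "(\<forall>z\<in>ball 0 1. f z \<in> vecs {..<N}) \<and> proper_on {..<N} f"
  have hol: "holo_on (ball 0 1) (\<lambda>z. f z i)" if "i < N" for i
    using P that by (auto simp: proper_on_def)
  have cont: "continuous_on (ball 0 1) f"
  proof (rule continuous_on_coordinatewise_then_product)
    fix i show "continuous_on (ball 0 1) (\<lambda>z. f z i)"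
    proof (cases "i < N")
      case False
      then have "f z i = 0" if "z \<in> ball 0 1" for z
        using P that by (auto simp: vecs_def)
      then show ?thesis by (intro continuous_on_eq[OF continuous_on_const[of _ 0]]) auto
    qed (rule holo_on_imp_continuous_on[OF hol])
  qed
  have "compact {z \<in> ball 0 1. f z \<in> K}" if K: "compact K" "K \<subseteq> vball N" for K
  proof (cases "K = {}")
    case False
    have "continuous_on K (\<lambda>x. (vnorm {..<N} x)\<^sup>2)"
      unfolding vnorm_sq
      by (intro continuous_intros continuous_on_subset[OF continuous_on_product_coordinates]) auto
    then obtain x where x: "x \<in> K" "\<And>y. y \<in> K \<Longrightarrow> (vnorm {..<N} y)\<^sup>2 \<le> (vnorm {..<N} x)\<^sup>2"
      using continuous_attains_sup[OF K(1) False] by blast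
    have "(vnorm {..<N} x)\<^sup>2 < 1" using x(1) K(2) by (auto simp: vball_def abs_square_less_1)
    then obtain r where r: "r < 1"
      "\<And>z. z \<in> ball 0 1 \<Longrightarrow> r < norm z \<Longrightarrow> (vnorm {..<N} x)\<^sup>2 < (vnorm {..<N} (f z))\<^sup>2"
      using P proper_on_properD[of "{..<N}" f "1 - (vnorm {..<N} x)\<^sup>2"] by auto
    \<comment> \<open>Outside \<open>cball 0 r\<close> the norm of \<open>f\<close> exceeds every
      norm in \<open>K\<close>. Replacing the open ball by a closed one makes the preimage closed by
      continuity.\<close>
    have eq: "{z \<in> ball 0 1. f z \<in> K} = {z \<in> cball 0 r. f z \<in> K}"
      using r x(2) by (force simp: not_less[symmetric])
    have "continuous_on (cball 0 r) f"
      using r(1) by (intro continuous_on_subset[OF cont]) auto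
    then have "closed {z \<in> cball 0 r. f z \<in> K}"
      using continuous_closed_preimage[of "cball 0 r" f K] K(1)
      by (auto simp: vimage_def Int_def compact_imp_closed)
    then show ?thesis
      unfolding eq compact_eq_bounded_closed
      using bounded_subset[OF bounded_cball[of 0 r], of "{z \<in> cball 0 r. f z \<in> K}"] by blast
  qed auto
  then show "proper_holo N f"
    using P by (auto simp: proper_holo_def vball_def proper_on_def abs_square_less_1)
qed

text \<open>Properness moves freely between targets with different index sets as long as the norms
  agree.\<close>

lemma proper_on_cong_norm:
  assumes "proper_on I f" "\<And>i. i \<in> J \<Longrightarrow> holo_on (ball 0 1) (\<lambda>z. g z i)"
    "\<And>z. z \<in> ball 0 1 \<Longrightarrow> (vnorm J (g z))\<^sup>2 = (vnorm I (f z))\<^sup>2"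
  shows "proper_on J g"
  using assms unfolding proper_on_def by simp

lemma proper_holo_cong:
  assumes "proper_holo M f" "\<And>z. z \<in> ball 0 1 \<Longrightarrow> g z = f z"
  shows "proper_holo M g"
proof -
  have "holo_on (ball 0 1) (\<lambda>z. g z i)" if "i \<in> {..<M}" for i
    using assms that holo_on_cong[of "ball 0 1" "\<lambda>z. g z i" "\<lambda>z. f z i"]
    by (auto simp: proper_holo_def)
  with assms proper_on_cong_norm[of "{..<M}" f "{..<M}" g] show ?thesis
    by (auto simp: proper_holo_iff)
qed

text \<open>The ends are prescribed exactly on the ball, not up to norm equivalence, which is what
  makes concatenation possible.\<close>

definition proper_homotopic ::
    "nat \<Rightarrow> (complex ^ 'n \<Rightarrow> nat \<Rightarrow> complex) \<Rightarrow> (complex ^ 'n \<Rightarrow> nat \<Rightarrow> complex) \<Rightarrow> bool" where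
  "proper_homotopic M f g \<longleftrightarrow>
     (\<exists>H. continuous_on (ball 0 1 \<times> {0..1}) H \<and>
        (\<forall>t\<in>{0..1::real}. proper_holo M (\<lambda>z. H (z, t))) \<and>
        (\<forall>z\<in>ball 0 1. H (z, 0) = f z \<and> H (z, 1) = g z))"

lemma proper_homotopicI:
  fixes H :: "(complex ^ 'n) \<times> real \<Rightarrow> nat \<Rightarrow> complex"
  assumes "\<And>z t. z \<in> ball 0 1 \<Longrightarrow> t \<in> {0..1} \<Longrightarrow> H (z, t) \<in> vecs {..<M}"
    and "\<And>i. i < M \<Longrightarrow> continuous_on (ball 0 1 \<times> {0..1}) (\<lambda>p. H p i)"
    and "\<And>t. t \<in> {0..1} \<Longrightarrow> proper_on {..<M} (\<lambda>z. H (z, t))"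
    and "\<And>z. z \<in> ball 0 1 \<Longrightarrow> H (z, 0) = f z" "\<And>z. z \<in> ball 0 1 \<Longrightarrow> H (z, 1) = g z"
  shows "proper_homotopic M f g"
proof -
  have "continuous_on (ball 0 1 \<times> {0..1}) H"
  proof (rule continuous_on_coordinatewise_then_product)
    fix i show "continuous_on (ball 0 1 \<times> {0..1}) (\<lambda>p. H p i)"
    proof (cases "i < M")
      case False
      then have "H p i = 0" if "p \<in> ball 0 1 \<times> {0..1}" for p
        using assms(1)[of "fst p" "snd p"] that by (auto simp: vecs_def)
      then show ?thesis by (intro continuous_on_eq[OF continuous_on_const[of _ 0]]) auto
    qed (rule assms(2))
  qed
  with assms show ?thesis
    unfolding proper_homotopic_def by (intro exI[of _ H]) (auto simp: proper_holo_iff)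
qed

lemma proper_homotopic_refl:
  assumes "proper_holo M f"
  shows "proper_homotopic M f f"
proof (rule proper_homotopicI[where H = "\<lambda>(z, t). f z"])
  fix i assume "i < M"
  then have "continuous_on (ball 0 1) (\<lambda>z. f z i)"
    using assms by (auto simp: proper_holo_def intro: holo_on_imp_continuous_on)
  then have "continuous_on (ball 0 1 \<times> {0..1::real}) (\<lambda>p. f (fst p) i)"
    by (rule continuous_on_compose2) (auto intro: continuous_intros)
  then show "continuous_on (ball 0 1 \<times> {0..1::real}) (\<lambda>p. (case p of (z, t) \<Rightarrow> f z) i)"
    by (simp add: case_prod_beta)
qed (use assms in \<open>auto simp: proper_holo_iff\<close>)

lemma proper_homotopic_proper:
  assumes "proper_homotopic M f g"
  shows "proper_holo M f" "proper_holo M g"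
proof -
  obtain H where H: "\<And>t::real. t\<in>{0..1} \<Longrightarrow> proper_holo M (\<lambda>z. H (z, t))"
      "\<And>z. z\<in>ball 0 1 \<Longrightarrow> H (z, 0) = f z" "\<And>z. z\<in>ball 0 1 \<Longrightarrow> H (z, 1) = g z"
    using assms unfolding proper_homotopic_def by blast
  show "proper_holo M f" using H by (intro proper_holo_cong[OF H(1)[of 0]]) auto
  show "proper_holo M g" using H by (intro proper_holo_cong[OF H(1)[of 1]]) auto
qed

lemma proper_homotopic_trans:
  assumes "proper_homotopic M f g" "proper_homotopic M g h"
  shows "proper_homotopic M f h"
proof -
  obtain H where H: "continuous_on (ball 0 1 \<times> {0..1}) H"
      "\<And>t::real. t\<in>{0..1} \<Longrightarrow> proper_holo M (\<lambda>z. H (z, t))"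
      "\<And>z. z\<in>ball 0 1 \<Longrightarrow> H (z, 0) = f z" "\<And>z. z\<in>ball 0 1 \<Longrightarrow> H (z, 1) = g z"
    using assms(1) unfolding proper_homotopic_def by blast
  obtain H' where H': "continuous_on (ball 0 1 \<times> {0..1}) H'"
      "\<And>t::real. t\<in>{0..1} \<Longrightarrow> proper_holo M (\<lambda>z. H' (z, t))"
      "\<And>z. z\<in>ball 0 1 \<Longrightarrow> H' (z, 0) = g z" "\<And>z. z\<in>ball 0 1 \<Longrightarrow> H' (z, 1) = h z"
    using assms(2) unfolding proper_homotopic_def by blast
  define G where "G = (\<lambda>p :: (complex ^ 'a) \<times> real.
    if snd p \<le> 1/2 then H (fst p, 2 * snd p) else H' (fst p, 2 * snd p - 1))"
  have "continuous_on (ball 0 1 \<times> {0..1}) G"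
    unfolding G_def
  proof (rule continuous_on_cases_le)
    show "continuous_on {t \<in> ball 0 1 \<times> {0..1}. snd t \<le> 1 / 2} (\<lambda>p. H (fst p, 2 * snd p))"
      by (intro continuous_on_compose2[OF H(1)] continuous_intros) auto
    show "continuous_on {t \<in> ball 0 1 \<times> {0..1}. 1 / 2 \<le> snd t} (\<lambda>p. H' (fst p, 2 * snd p - 1))"
      by (intro continuous_on_compose2[OF H'(1)] continuous_intros) auto
    fix p :: "(complex ^ 'a) \<times> real" assume p: "p \<in> ball 0 1 \<times> {0..1}" "snd p = 1 / 2"
    then have "2 * snd p = 1" by simp
    with p show "H (fst p, 2 * snd p) = H' (fst p, 2 * snd p - 1)"
      by (auto simp: H H')
  qed (intro continuous_intros)
  moreover have "proper_holo M (\<lambda>z. G (z, t))" if "t \<in> {0..1}" for t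
    using H(2)[of "2 * t"] H'(2)[of "2 * t - 1"] that by (cases "t \<le> 1 / 2") (simp_all add: G_def)
  ultimately show ?thesis
    unfolding proper_homotopic_def
    by (intro exI[of _ G]) (auto simp: G_def H H')
qed

subsection \<open>Maps with the same Gram kernel\<close>

text \<open>The polarized form of norm equivalence, for targets that may have different index
  sets.\<close>

definition same_gram ::
    "'i set \<Rightarrow> (complex ^ 'n \<Rightarrow> 'i \<Rightarrow> complex) \<Rightarrow> 'j set \<Rightarrow> (complex ^ 'n \<Rightarrow> 'j \<Rightarrow> complex) \<Rightarrow> bool" where
  "same_gram I f J g \<longleftrightarrow>
     (\<forall>z\<in>ball 0 1. \<forall>w\<in>ball 0 1. vinner I (f z) (f w) = vinner J (g z) (g w))"

lemma same_gramD:
  "same_gram I f J g \<Longrightarrow> z \<in> ball 0 1 \<Longrightarrow> w \<in> ball 0 1 \<Longrightarrow> vinner I (f z) (f w) = vinner J (g z) (g w)"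
  by (simp add: same_gram_def)

text \<open>The map fixes the complement of \<open>w\<close> and multiplies the line of
  \<open>w\<close> by 1 + \<alpha> <w,w>. Times <w,w>, the hypothesis says that this factor has
  modulus 1.\<close>

lemma vinner_reflection:
  assumes "\<alpha> + cnj \<alpha> + \<alpha> * cnj \<alpha> * vinner I w w = 0"
  shows "vinner I (x + vscale (\<alpha> * vinner I x w) w) (y + vscale (\<alpha> * vinner I y w) w) = vinner I x y"
proof -
  have "vinner I (x + vscale (\<alpha> * vinner I x w) w) (y + vscale (\<alpha> * vinner I y w) w) =
      vinner I x y + vinner I x w * vinner I w y * (\<alpha> + cnj \<alpha> + \<alpha> * cnj \<alpha> * vinner I w w)"
    by (simp add: vinner_linear vinner_commute[of I w y] algebra_simps)
  with assms show ?thesis by simp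
qed

text \<open>
  With \<open>w = f \<zeta> - g \<zeta>\<close>, the equal norms of \<open>f \<zeta>\<close> and \<open>g \<zeta>\<close> make some rotation of the line spanned
  by \<open>w\<close> send \<open>f \<zeta>\<close> to \<open>g \<zeta>\<close>.  The points \<open>\<xi>\<close> where \<open>f\<close> and \<open>g\<close> already agree are not moved,
  since equality of the Gram kernels makes \<open>f \<xi>\<close> orthogonal to \<open>w\<close>.
\<close>

lemma proper_homotopic_reflection:
  assumes f: "proper_holo M f" and g: "proper_holo M g"
    and fg: "same_gram {..<M} f {..<M} g" and \<zeta>: "\<zeta> \<in> ball 0 1"
  obtains f' where "proper_homotopic M f f'" "same_gram {..<M} f' {..<M} g" "f' \<zeta> = g \<zeta>"
    "\<And>\<xi>. \<xi> \<in> ball 0 1 \<Longrightarrow> f \<xi> = g \<xi> \<Longrightarrow> f' \<xi> = g \<xi>"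
proof (cases "f \<zeta> = g \<zeta>")
  case True
  then show ?thesis using f fg by (intro that[of f]) (auto intro: proper_homotopic_refl)
next
  case False
  define ip where "ip = vinner {..<M}"
  define w where "w = f \<zeta> - g \<zeta>"
  define c where "c = ip (f \<zeta>) w"
  have vecs: "f z \<in> vecs {..<M}" "g z \<in> vecs {..<M}" if "z \<in> ball 0 1" for z
    using f g that by (auto simp: proper_holo_iff)
  have w_vecs: "w \<in> vecs {..<M}" using vecs[OF \<zeta>] by (auto simp: w_def vecs_closed)
  have "ip w w \<noteq> 0"
    using vinner_eq_zeroD[OF _ _ w_vecs] False by (auto simp: w_def ip_def)
  \<comment> \<open>Equal norms of \<open>f \<zeta>\<close> and \<open>g \<zeta>\<close> enter
    here.\<close>
  have ipw: "ip w w = c + cnj c"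
  proof -
    have "cnj (ip (g \<zeta>) (g \<zeta>)) = ip (g \<zeta>) (g \<zeta>)" by (simp add: ip_def vinner_self)
    then show ?thesis
      using same_gramD[OF fg \<zeta> \<zeta>]
      by (simp add: w_def c_def ip_def vinner_linear vinner_commute[of "{..<M}" "g \<zeta>" "f \<zeta>"])
  qed
  then have "c \<noteq> 0" using \<open>ip w w \<noteq> 0\<close> by auto
  \<comment> \<open>Sending \<open>f \<zeta>\<close> to \<open>f \<zeta> - w\<close> requires
    \<alpha> c = -1, hence the factor 1 - <w,w>/c = -cnj c / c on the line of \<open>w\<close>. It
    has modulus 1, so it is joined to 1 by the rotations \<open>cis (\<theta> * t)\<close>.\<close>
  define \<theta> where "\<theta> = Arg (- cnj c / c)"
  have "cmod (- cnj c / c) = 1" using \<open>c \<noteq> 0\<close> by (simp add: norm_divide)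
  then have cis: "cis \<theta> = - cnj c / c"
    using cis_Arg[of "- cnj c / c"] \<open>c \<noteq> 0\<close> by (simp add: \<theta>_def sgn_eq)
  define \<alpha> where "\<alpha> = (\<lambda>t::real. (cis (\<theta> * t) - 1) / ip w w)"
  have \<alpha>: "\<alpha> t + cnj (\<alpha> t) + \<alpha> t * cnj (\<alpha> t) * ip w w = 0" for t
  proof -
    define E where "E = cis (\<theta> * t)"
    define V where "V = inverse (ip w w)"
    have "cnj V = V" by (simp add: V_def ipw add.commute)
    then have \<alpha>t: "\<alpha> t = (E - 1) * V" "cnj (\<alpha> t) = (cnj E - 1) * V"
      by (simp_all add: \<alpha>_def E_def V_def divide_inverse)
    have "V * ip w w = 1" using \<open>ip w w \<noteq> 0\<close> by (simp add: V_def)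
    then have "\<alpha> t + cnj (\<alpha> t) + \<alpha> t * cnj (\<alpha> t) * ip w w =
        ((E - 1) + (cnj E - 1) + (E - 1) * (cnj E - 1)) * V"
      unfolding \<alpha>t(2) unfolding \<alpha>t(1) by algebra
    also have "(E - 1) + (cnj E - 1) + (E - 1) * (cnj E - 1) = E * cnj E - 1"
      by (simp add: algebra_simps)
    also have "E * cnj E = 1" by (simp add: E_def cis_cnj cis_mult)
    finally show ?thesis by simp
  qed
  define H where "H = (\<lambda>(z, t). f z + vscale (\<alpha> t * ip (f z) w) w)"
  have gram: "vinner {..<M} (H (z, t)) (H (z', t)) = vinner {..<M} (f z) (f z')" for z z' t
    using vinner_reflection[OF \<alpha>[of t, unfolded ip_def]] by (simp add: H_def ip_def)
  have fhol: "holo_on (ball 0 1) (\<lambda>z. f z i)" if "i \<in> {..<M}" for i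
    using f that by (auto simp: proper_holo_def)
  have fcont: "continuous_on (ball 0 1 \<times> {0..1::real}) (\<lambda>p. f (fst p) i)" if "i \<in> {..<M}" for i
    using holo_on_imp_continuous_on[OF fhol[OF that]]
    by (rule continuous_on_compose2) (auto intro: continuous_intros)
  have H_i: "H (z, t) i = f z i + \<alpha> t * (\<Sum>j<M. f z j * cnj (w j)) * w i" for z t i
    by (simp add: H_def ip_def vinner_def vscale_def)
  have "proper_homotopic M f (\<lambda>z. H (z, 1))"
  proof (rule proper_homotopicI[where H = H])
    fix t :: real
    have "holo_on (ball 0 1) (\<lambda>z. H (z, t) i)" if "i \<in> {..<M}" for i
      unfolding H_i by (intro holo_on_intros fhol that) auto
    moreover have "(vnorm {..<M} (H (z, t)))\<^sup>2 = (vnorm {..<M} (f z))\<^sup>2" for z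
      using gram[of z t z] unfolding vinner_self of_real_eq_iff .
    ultimately show "proper_on {..<M} (\<lambda>z. H (z, t))"
      using f proper_on_cong_norm[of "{..<M}" f "{..<M}"] by (auto simp: proper_holo_iff)
  next
    fix i assume i: "i < M"
    have "continuous_on (ball 0 1 \<times> {0..1})
        (\<lambda>p. f (fst p) i + \<alpha> (snd p) * (\<Sum>j<M. f (fst p) j * cnj (w j)) * w i)"
      unfolding \<alpha>_def using i \<open>ip w w \<noteq> 0\<close>
      by (intro continuous_intros fcont) auto
    then show "continuous_on (ball 0 1 \<times> {0..1}) (\<lambda>p. H p i)"
      by (simp add: H_i[of "fst p" "snd p" for p, simplified])
  next
    show "H (z, t) \<in> vecs {..<M}" if "z \<in> ball 0 1" for z t
      using that by (simp add: H_def vecs vecs_closed w_vecs)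
    show "H (z, 0) = f z" for z
      by (auto simp: H_def \<alpha>_def vscale_def)
  qed simp
  moreover have "same_gram {..<M} (\<lambda>z. H (z, 1)) {..<M} g"
    using fg gram by (simp add: same_gram_def)
  moreover have "\<alpha> 1 * c = - 1"
  proof -
    have "(cis \<theta> - 1) * c = - ip w w" using \<open>c \<noteq> 0\<close> by (simp add: cis ipw algebra_simps)
    then show ?thesis using \<open>ip w w \<noteq> 0\<close> by (simp add: \<alpha>_def)
  qed
  then have "H (\<zeta>, 1) = f \<zeta> + vscale (- 1) w"
    by (simp add: H_def c_def[symmetric])
  then have "H (\<zeta>, 1) = g \<zeta>"
    by (simp add: w_def fun_eq_iff vscale_def)
  moreover have "H (\<xi>, 1) = g \<xi>" if \<xi>: "\<xi> \<in> ball 0 1" "f \<xi> = g \<xi>" for \<xi>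
  proof -
    have "ip (f \<xi>) w = 0"
      using same_gramD[OF fg \<xi>(1) \<zeta>] \<xi>(2) by (simp add: ip_def w_def vinner_linear)
    with \<xi> show ?thesis by (simp add: H_def fun_eq_iff vscale_def)
  qed
  ultimately show ?thesis by (rule that)
qed

text \<open>The spanning vectors are taken among the values of \<open>f\<close> itself, so that they
  correspond to points at which two maps can be compared.\<close>

lemma finite_spanning_points:
  fixes f :: "'a \<Rightarrow> nat \<Rightarrow> complex"
  assumes "f ` X \<subseteq> vecs {..<M}"
  obtains Z where "Z \<subseteq> X" "finite Z" "\<And>x. x \<in> X \<Longrightarrow> \<exists>c. f x = (\<Sum>\<zeta>\<in>Z. vscale (c \<zeta>) (f \<zeta>))"
proof -
  define \<delta> :: "nat \<Rightarrow> nat \<Rightarrow> complex" where "\<delta> = (\<lambda>i j. if j = i then 1 else 0)"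
  have "vecs {..<M} \<subseteq> cvec.span (\<delta> ` {..<M})"
  proof
    fix x :: "nat \<Rightarrow> complex" assume "x \<in> vecs {..<M}"
    then have "x = (\<Sum>i<M. vscale (x i) (\<delta> i))"
      by (auto simp: fun_eq_iff sum_fun_apply vscale_def \<delta>_def vecs_def if_distrib[of "(*) _"] cong: if_cong)
    also have "\<dots> \<in> cvec.span (\<delta> ` {..<M})"
      by (intro cvec.span_sum cvec.span_scale cvec.span_base) auto
    finally show "x \<in> cvec.span (\<delta> ` {..<M})" .
  qed
  moreover obtain B where B: "B \<subseteq> f ` X" "cvec.independent B" "f ` X \<subseteq> cvec.span B"
    by (rule cvec.maximal_independent_subset)
  ultimately have "finite B"
    using assms cvec.independent_span_bound[of "\<delta> ` {..<M}" B] by blast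
  obtain Z where Z: "Z \<subseteq> X" "inj_on f Z" "B = f ` Z"
    using B(1) by (auto simp: subset_image_inj)
  show thesis
  proof (rule that[of Z])
    show "finite Z" using \<open>finite B\<close> Z by (auto dest: finite_imageD)
    fix x assume "x \<in> X"
    then obtain u where "f x = (\<Sum>v\<in>B. vscale (u v) v)"
      using B(3) cvec.span_finite[OF \<open>finite B\<close>] by auto
    also have "\<dots> = (\<Sum>\<zeta>\<in>Z. vscale (u (f \<zeta>)) (f \<zeta>))"
      unfolding Z(3) by (simp add: sum.reindex[OF Z(2)])
    finally show "\<exists>c. f x = (\<Sum>\<zeta>\<in>Z. vscale (c \<zeta>) (f \<zeta>))" by (rule exI[of _ "\<lambda>\<zeta>. u (f \<zeta>)"])
  qed (rule Z(1))
qed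

text \<open>The squared norm of the defect of a linear relation expands into Gram entries alone, so
  a relation among values of \<open>f\<close> holds for \<open>g\<close> as well.\<close>

lemma same_gram_combination:
  fixes M :: nat
  assumes fg: "same_gram {..<M} f {..<M} g" and "g ` ball 0 1 \<subseteq> vecs {..<M}"
    and Z: "Z \<subseteq> ball 0 1" and z: "z \<in> ball 0 1"
    and fz: "f z = (\<Sum>\<zeta>\<in>Z. vscale (c \<zeta>) (f \<zeta>))"
  shows "g z = (\<Sum>\<zeta>\<in>Z. vscale (c \<zeta>) (g \<zeta>))"
proof -
  have expand: "vinner {..<M} (h z - (\<Sum>\<zeta>\<in>Z. vscale (c \<zeta>) (h \<zeta>))) (h z - (\<Sum>\<zeta>\<in>Z. vscale (c \<zeta>) (h \<zeta>)))
    = vinner {..<M} (h z) (h z) - (\<Sum>\<zeta>\<in>Z. c \<zeta> * vinner {..<M} (h \<zeta>) (h z))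
      - (\<Sum>\<zeta>\<in>Z. cnj (c \<zeta>) * (vinner {..<M} (h z) (h \<zeta>) - (\<Sum>\<eta>\<in>Z. c \<eta> * vinner {..<M} (h \<eta>) (h \<zeta>))))"
    for h
    by (simp add: vinner_linear vinner_sum)
  have "vinner {..<M} (g z - (\<Sum>\<zeta>\<in>Z. vscale (c \<zeta>) (g \<zeta>))) (g z - (\<Sum>\<zeta>\<in>Z. vscale (c \<zeta>) (g \<zeta>)))
    = vinner {..<M} (f z - (\<Sum>\<zeta>\<in>Z. vscale (c \<zeta>) (f \<zeta>))) (f z - (\<Sum>\<zeta>\<in>Z. vscale (c \<zeta>) (f \<zeta>)))"
    unfolding expand using Z z
    by (intro arg_cong2[where f = "(-)"] sum.cong arg_cong2[where f = "(*)"] refl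
        same_gramD[OF fg, symmetric]) auto
  also have "\<dots> = 0" by (simp add: fz vinner_linear)
  finally have "g z - (\<Sum>\<zeta>\<in>Z. vscale (c \<zeta>) (g \<zeta>)) = 0"
    using assms by (intro vinner_eq_zeroD[of "{..<M}"]) (auto intro!: vecs_closed vecs_sum)
  then show ?thesis by simp
qed

lemma proper_homotopic_of_same_gram:
  assumes f: "proper_holo M f" and g: "proper_holo M g" and fg: "same_gram {..<M} f {..<M} g"
  shows "proper_homotopic M f g"
proof -
  have gv: "g ` ball 0 1 \<subseteq> vecs {..<M}" using g by (auto simp: proper_holo_iff)
  \<comment> \<open>The points are chosen for \<open>g\<close>, which stays the same while
    \<open>f\<close> is rotated repeatedly.\<close>
  obtain Z where Z: "Z \<subseteq> ball 0 1" "finite Z"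
    "\<And>x. x \<in> ball 0 1 \<Longrightarrow> \<exists>c. g x = (\<Sum>\<zeta>\<in>Z. vscale (c \<zeta>) (g \<zeta>))"
    using finite_spanning_points[OF gv] by blast
  have "\<exists>f'. proper_homotopic M f f' \<and> same_gram {..<M} f' {..<M} g \<and> (\<forall>\<zeta>\<in>Z. f' \<zeta> = g \<zeta>)"
    using Z(2,1)
  proof (induction Z rule: finite_induct)
    case empty
    then show ?case using f fg proper_homotopic_refl by blast
  next
    case (insert \<zeta> Z)
    then obtain f' where f': "proper_homotopic M f f'" "same_gram {..<M} f' {..<M} g"
      "\<forall>\<zeta>\<in>Z. f' \<zeta> = g \<zeta>" by auto
    have \<zeta>: "\<zeta> \<in> ball 0 1" using insert.prems by simp
    obtain f'' where f'': "proper_homotopic M f' f''" "same_gram {..<M} f'' {..<M} g" "f'' \<zeta> = g \<zeta>"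
      "\<And>\<xi>. \<xi> \<in> ball 0 1 \<Longrightarrow> f' \<xi> = g \<xi> \<Longrightarrow> f'' \<xi> = g \<xi>"
      by (rule proper_homotopic_reflection[OF proper_homotopic_proper(2)[OF f'(1)] g f'(2) \<zeta>]) (rule that)
    have "proper_homotopic M f f''"
      by (rule proper_homotopic_trans[OF f'(1) f''(1)])
    then show ?case
      using f'(3) f''(2,3,4) insert.prems by (intro exI[of _ f'']) auto
  qed
  then obtain f' where f': "proper_homotopic M f f'" "same_gram {..<M} f' {..<M} g"
    "\<forall>\<zeta>\<in>Z. f' \<zeta> = g \<zeta>" by blast
  have "f' z = g z" if z: "z \<in> ball 0 1" for z
  \<comment> \<open>Once the maps agree on \<open>Z\<close>, the relation expressing
    \<open>g z\<close> through \<open>Z\<close> transfers back to \<open>f'\<close>.\<close>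
  proof -
    obtain c where c: "g z = (\<Sum>\<zeta>\<in>Z. vscale (c \<zeta>) (g \<zeta>))" using Z(3)[OF z] by blast
    have gf: "same_gram {..<M} g {..<M} f'" using f'(2) by (simp add: same_gram_def)
    have "f' ` ball 0 1 \<subseteq> vecs {..<M}"
      using proper_homotopic_proper(2)[OF f'(1)] by (auto simp: proper_holo_iff)
    then have "f' z = (\<Sum>\<zeta>\<in>Z. vscale (c \<zeta>) (f' \<zeta>))"
      by (rule same_gram_combination[OF gf _ Z(1) z c])
    also have "\<dots> = g z" unfolding c using f'(3) by (intro sum.cong) auto
    finally show ?thesis .
  qed
  then show ?thesis using f'(1) unfolding proper_homotopic_def by simp
qed

subsection \<open>Undoing a tensor product\<close>

text \<open>Only the kernels of the ends are recorded; the maps realizing them are left open, so no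
  embedding into the common target has to be chosen.\<close>

definition gram_homotopic ::
    "nat \<Rightarrow> (complex ^ 'n \<Rightarrow> complex ^ 'n \<Rightarrow> complex) \<Rightarrow> (complex ^ 'n \<Rightarrow> complex ^ 'n \<Rightarrow> complex) \<Rightarrow> bool" where
  "gram_homotopic M K L \<longleftrightarrow>
     (\<exists>f g. proper_homotopic M f g \<and>
        (\<forall>z\<in>ball 0 1. \<forall>w\<in>ball 0 1. vinner {..<M} (f z) (f w) = K z w \<and> vinner {..<M} (g z) (g w) = L z w))"

lemma gram_homotopic_cong:
  assumes "gram_homotopic M K L"
    and "\<And>z w. z \<in> ball 0 1 \<Longrightarrow> w \<in> ball 0 1 \<Longrightarrow> K' z w = K z w"
    and "\<And>z w. z \<in> ball 0 1 \<Longrightarrow> w \<in> ball 0 1 \<Longrightarrow> L' z w = L z w"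
  shows "gram_homotopic M K' L'"
  using assms unfolding gram_homotopic_def by simp

lemma gram_homotopic_trans:
  assumes "gram_homotopic M K L" "gram_homotopic M L R"
  shows "gram_homotopic M K R"
proof -
  obtain f g where fg: "proper_homotopic M f g"
      "\<And>z w. z \<in> ball 0 1 \<Longrightarrow> w \<in> ball 0 1 \<Longrightarrow> vinner {..<M} (f z) (f w) = K z w"
      "\<And>z w. z \<in> ball 0 1 \<Longrightarrow> w \<in> ball 0 1 \<Longrightarrow> vinner {..<M} (g z) (g w) = L z w"
    using assms(1) unfolding gram_homotopic_def by blast
  obtain f' g' where fg': "proper_homotopic M f' g'"
      "\<And>z w. z \<in> ball 0 1 \<Longrightarrow> w \<in> ball 0 1 \<Longrightarrow> vinner {..<M} (f' z) (f' w) = L z w"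
      "\<And>z w. z \<in> ball 0 1 \<Longrightarrow> w \<in> ball 0 1 \<Longrightarrow> vinner {..<M} (g' z) (g' w) = R z w"
    using assms(2) unfolding gram_homotopic_def by blast
  have "same_gram {..<M} g {..<M} f'"
    using fg(3) fg'(2) by (simp add: same_gram_def)
  then have "proper_homotopic M g f'"
    by (rule proper_homotopic_of_same_gram[OF proper_homotopic_proper(2)[OF fg(1)]
          proper_homotopic_proper(1)[OF fg'(1)]])
  then have "proper_homotopic M f g'"
    by (rule proper_homotopic_trans[OF proper_homotopic_trans[OF fg(1)] fg'(1)])
  then show ?thesis
    unfolding gram_homotopic_def using fg(2) fg'(3) by (intro exI[of _ f] exI[of _ g']) auto
qed

text \<open>Any finite index set with at most \<open>M\<close> elements may serve as target: it is
  enumerated and padded by zeros, which changes no inner product.\<close>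

lemma gram_homotopicI:
  fixes H :: "complex ^ 'n \<Rightarrow> real \<Rightarrow> 'i \<Rightarrow> complex"
  assumes I: "finite I" "card I \<le> M"
    and cont: "\<And>i. i \<in> I \<Longrightarrow> continuous_on (ball 0 1 \<times> {0..1}) (\<lambda>p. H (fst p) (snd p) i)"
    and proper: "\<And>t. t \<in> {0..1} \<Longrightarrow> proper_on I (\<lambda>z. H z t)"
    and K: "\<And>z w. z \<in> ball 0 1 \<Longrightarrow> w \<in> ball 0 1 \<Longrightarrow> vinner I (H z 0) (H w 0) = K z w"
    and L: "\<And>z w. z \<in> ball 0 1 \<Longrightarrow> w \<in> ball 0 1 \<Longrightarrow> vinner I (H z 1) (H w 1) = L z w"
  shows "gram_homotopic M K L"
proof -
  obtain e where e: "bij_betw e {..<card I} I"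
    using ex_bij_betw_nat_finite[OF I(1)] by (auto simp: lessThan_atLeast0)
  define G where "G = (\<lambda>(z, t) j. if j < card I then H z t (e j) else 0)"
  have gram: "vinner {..<M} (G (z, t)) (G (w, s)) = vinner I (H z t) (H w s)" for z t w s
  proof -
    have "vinner {..<M} (G (z, t)) (G (w, s)) = (\<Sum>j<card I. H z t (e j) * cnj (H w s (e j)))"
      unfolding vinner_def using I(2)
      by (intro sum.mono_neutral_cong_right) (auto simp: G_def)
    also have "\<dots> = vinner I (H z t) (H w s)"
      unfolding vinner_def by (rule sum.reindex_bij_betw[OF e])
    finally show ?thesis .
  qed
  have eI: "e j \<in> I" if "j < card I" for j
    using e that by (auto simp: bij_betw_def)
  have "proper_homotopic M (\<lambda>z. G (z, 0)) (\<lambda>z. G (z, 1))"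
  proof (rule proper_homotopicI[where H = G])
    fix t :: real assume t: "t \<in> {0..1}"
    show "G (z, t) \<in> vecs {..<M}" for z
      using I(2) by (auto simp: vecs_def G_def)
    have "holo_on (ball 0 1) (\<lambda>z. G (z, t) j)" for j
      using proper[OF t] eI[of j]
      by (cases "j < card I") (auto simp: G_def proper_on_def intro: holo_on_const)
    moreover have "(vnorm {..<M} (G (z, t)))\<^sup>2 = (vnorm I (H z t))\<^sup>2" for z
      using gram[of z t z t] unfolding vinner_self of_real_eq_iff .
    ultimately show "proper_on {..<M} (\<lambda>z. G (z, t))"
      by (rule proper_on_cong_norm[OF proper[OF t]])
  next
    fix j assume "j < M"
    show "continuous_on (ball 0 1 \<times> {0..1}) (\<lambda>p. G p j)"
      using cont[OF eI[of j]]
      by (cases "j < card I") (auto simp: G_def case_prod_beta)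
  qed auto
  then show ?thesis
    unfolding gram_homotopic_def by (intro exI conjI) (assumption, simp add: gram K L)
qed

abbreviation hinner :: "complex ^ 'n \<Rightarrow> complex ^ 'n \<Rightarrow> complex" where
  "hinner v w \<equiv> vinner UNIV (($) v) (($) w)"

text \<open>
  The vector \<open>u\<close> with its component \<open>b\<close> replaced by \<open>sqrt (m b) u\<^sub>b v \<oplus> sqrt (1 - m b) u\<^sub>b\<close>.  For
  \<open>m b \<in> {0, 1}\<close> one of the two summands vanishes and its index can be dropped from the target.
\<close>

definition partial_tensor :: "('b \<Rightarrow> real) \<Rightarrow> ('b \<Rightarrow> complex) \<Rightarrow> complex ^ 'n \<Rightarrow> 'b \<times> 'n option \<Rightarrow> complex" where
  "partial_tensor m u v = (\<lambda>(b, l). case l of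
     None \<Rightarrow> of_real (sqrt (1 - m b)) * u b | Some l \<Rightarrow> of_real (sqrt (m b)) * u b * v $ l)"

text \<open>The square roots make the kernel affine in \<open>m b\<close>, between the factor <v,w>
  and the factor 1. The last hypothesis permits dropping indices whose component vanishes
  identically; the dimension count rests on this.\<close>

lemma vinner_partial_tensor:
  fixes v w :: "complex ^ 'n"
  assumes "finite B" "\<And>b. b \<in> B \<Longrightarrow> 0 \<le> m b \<and> m b \<le> 1" and I: "I \<subseteq> B \<times> UNIV"
    and zero: "\<And>p u v. p \<in> B \<times> UNIV - I \<Longrightarrow> partial_tensor m u v p = 0"
  shows "vinner I (partial_tensor m u v) (partial_tensor m u' w) =
    (\<Sum>b\<in>B. u b * cnj (u' b) * (of_real (m b) * hinner v w + of_real (1 - m b)))"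
proof -
  have sq: "complex_of_real (sqrt r) * complex_of_real (sqrt r) = complex_of_real r" if "0 \<le> r" for r
    using that by (simp flip: of_real_mult)
  have "vinner I (partial_tensor m u v) (partial_tensor m u' w) =
      vinner (B \<times> UNIV) (partial_tensor m u v) (partial_tensor m u' w)"
    unfolding vinner_def using assms
    by (intro sum.mono_neutral_left) auto
  also have "\<dots> = (\<Sum>b\<in>B. \<Sum>l\<in>UNIV. partial_tensor m u v (b, l) * cnj (partial_tensor m u' w (b, l)))"
    unfolding vinner_def by (simp add: sum.cartesian_product)
  also have "\<dots> = (\<Sum>b\<in>B. u b * cnj (u' b) * (of_real (m b) * hinner v w + of_real (1 - m b)))"
  proof (rule sum.cong)
    fix b assume "b \<in> B"
    then have m: "0 \<le> m b" "m b \<le> 1" using assms(2) by auto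
    let ?s = "complex_of_real (sqrt (1 - m b))" and ?r = "complex_of_real (sqrt (m b))"
    have "(\<Sum>l\<in>UNIV. partial_tensor m u v (b, l) * cnj (partial_tensor m u' w (b, l)))
        = (?s * u b) * (?s * cnj (u' b)) + (\<Sum>l\<in>UNIV. (?r * u b * v $ l) * (?r * cnj (u' b) * cnj (w $ l)))"
      by (simp add: UNIV_option_conv sum.insert partial_tensor_def sum.reindex)
    also have "\<dots> = u b * cnj (u' b) * (?s * ?s) + (?r * ?r) * (u b * cnj (u' b)) * hinner v w"
      by (simp add: vinner_def sum_distrib_left mult_ac)
    also have "\<dots> = u b * cnj (u' b) * (of_real (m b) * hinner v w + of_real (1 - m b))"
      using m by (simp only: sq) (simp add: algebra_simps)
    finally show "(\<Sum>l\<in>UNIV. partial_tensor m u v (b, l) * cnj (partial_tensor m u' w (b, l))) =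
      u b * cnj (u' b) * (of_real (m b) * hinner v w + of_real (1 - m b))" .
  qed simp
  finally show ?thesis .
qed

text \<open>The squared norm lies between |f|^2 |\<phi>|^2 and |f|^2. Both tend to 1 at the sphere;
  since (1 - |f|^2)(1 - |\<phi>|^2) is nonnegative, the lower one is at least |f|^2 + |\<phi>|^2 -
  1, whence the split into halves of \<open>e\<close>.\<close>

lemma proper_on_partial_tensor:
  fixes \<phi> :: "complex ^ 'n \<Rightarrow> complex ^ 'n"
  assumes f: "proper_on B f" and \<phi>: "proper_on UNIV (\<lambda>z. ($) (\<phi> z))"
    and m: "finite B" "\<And>b. b \<in> B \<Longrightarrow> 0 \<le> m b \<and> m b \<le> 1" and I: "I \<subseteq> B \<times> UNIV"
    and zero: "\<And>p u v. p \<in> B \<times> UNIV - I \<Longrightarrow> partial_tensor m u (v :: complex ^ 'n) p = 0"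
  shows "proper_on I (\<lambda>z. partial_tensor m (f z) (\<phi> z))"
proof -
  let ?n = "\<lambda>z. (vnorm UNIV (($) (\<phi> z)))\<^sup>2"
  let ?h = "\<lambda>z. partial_tensor m (f z) (\<phi> z)"
  have norm: "(vnorm I (?h z))\<^sup>2 = (\<Sum>b\<in>B. (cmod (f z b))\<^sup>2 * (m b * ?n z + (1 - m b)))" for z
  proof -
    have "complex_of_real ((vnorm I (?h z))\<^sup>2) =
        complex_of_real (\<Sum>b\<in>B. (cmod (f z b))\<^sup>2 * (m b * ?n z + (1 - m b)))"
      using vinner_partial_tensor[OF m I zero, of "f z" "\<phi> z" "f z" "\<phi> z"]
      unfolding vinner_self by (simp add: complex_norm_square[symmetric])
    then show ?thesis by (simp only: of_real_eq_iff)
  qed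
  have n: "?n z < 1" if "z \<in> ball 0 1" for z
    using \<phi> that by (simp add: proper_on_def)
  have upper: "(vnorm I (?h z))\<^sup>2 \<le> (vnorm B (f z))\<^sup>2" if z: "z \<in> ball 0 1" for z
    unfolding norm vnorm_sq[of B]
  proof (rule sum_mono)
    fix b assume "b \<in> B"
    then have "m b * ?n z \<le> m b * 1" using m n[OF z] by (intro mult_left_mono) auto
    then show "(cmod (f z b))\<^sup>2 * (m b * ?n z + (1 - m b)) \<le> (cmod (f z b))\<^sup>2"
      by (intro mult_left_le) auto
  qed
  have lower: "(vnorm B (f z))\<^sup>2 + ?n z - 1 \<le> (vnorm I (?h z))\<^sup>2" if z: "z \<in> ball 0 1" for z
  proof -
    have "(vnorm B (f z))\<^sup>2 * ?n z \<le> (vnorm I (?h z))\<^sup>2"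
      unfolding norm vnorm_sq[of B] sum_distrib_right
    proof (rule sum_mono)
      fix b assume "b \<in> B"
      then have "(1 - m b) * ?n z \<le> (1 - m b) * 1" using m n[OF z] by (intro mult_left_mono) auto
      then show "(cmod (f z b))\<^sup>2 * ?n z \<le> (cmod (f z b))\<^sup>2 * (m b * ?n z + (1 - m b))"
        by (intro mult_left_mono) (auto simp: algebra_simps)
    qed
    moreover have "(1 - (vnorm B (f z))\<^sup>2) * (1 - ?n z) \<ge> 0"
      using n[OF z] f z by (intro mult_nonneg_nonneg) (auto simp: proper_on_def less_imp_le)
    ultimately show ?thesis by (simp add: algebra_simps)
  qed
  show ?thesis unfolding proper_on_def
  proof (intro conjI ballI allI impI)
    fix p assume "p \<in> I"
    then obtain b l where p: "p = (b, l)" "b \<in> B" using I by blast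
    then have "holo_on (ball 0 1) (\<lambda>z. f z b)" "holo_on (ball 0 1) (\<lambda>z. \<phi> z $ i)" for i
      using f \<phi> by (auto simp: proper_on_def)
    then show "holo_on (ball 0 1) (\<lambda>z. ?h z p)"
      unfolding p partial_tensor_def by (cases l) (auto intro!: holo_on_intros)
  next
    fix z :: "complex ^ 'n" assume "z \<in> ball 0 1"
    moreover from this have "(vnorm B (f z))\<^sup>2 < 1" using f by (simp add: proper_on_def)
    ultimately show "(vnorm I (?h z))\<^sup>2 < 1" by (rule le_less_trans[OF upper])
  next
    fix e :: real assume "0 < e"
    obtain r where r: "r < 1" "\<And>z. z \<in> ball 0 1 \<Longrightarrow> r < norm z \<Longrightarrow> 1 - e / 2 < (vnorm B (f z))\<^sup>2"
      using proper_on_properD[OF f, of "e / 2"] \<open>0 < e\<close> by auto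
    obtain s where s: "s < 1" "\<And>z. z \<in> ball 0 1 \<Longrightarrow> s < norm z \<Longrightarrow> 1 - e / 2 < ?n z"
      using proper_on_properD[OF \<phi>, of "e / 2"] \<open>0 < e\<close> by auto
    have "1 - e < (vnorm I (?h z))\<^sup>2" if "z \<in> ball 0 1" "max r s < norm z" for z
      using r(2)[OF that(1)] s(2)[OF that(1)] lower[OF that(1)] that(2) by (simp add: field_simps)
    then show "\<exists>r<1. \<forall>z\<in>ball 0 1. r < norm z \<longrightarrow> 1 - e < (vnorm I (?h z))\<^sup>2"
      using r(1) s(1) by (intro exI[of _ "max r s"]) auto
  qed
qed

lemma proper_on_imp_continuous_on:
  assumes "proper_on I f" "i \<in> I"
  shows "continuous_on (ball 0 1 \<times> {0..1::real}) (\<lambda>p. f (fst p) i)"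
proof -
  have "continuous_on (ball 0 1) (\<lambda>z. f z i)"
    using assms by (intro holo_on_imp_continuous_on) (simp add: proper_on_def)
  then show ?thesis
    by (rule continuous_on_compose2) (auto intro: continuous_intros)
qed

lemma gram_homotopic_refl:
  assumes "finite I" "card I \<le> M" "proper_on I f"
  shows "gram_homotopic M (\<lambda>z w. vinner I (f z) (f w)) (\<lambda>z w. vinner I (f z) (f w))"
  using assms
  by (intro gram_homotopicI[where H = "\<lambda>z t. f z" and I = I]) (auto intro: proper_on_imp_continuous_on)

text \<open>Induction on the set of coordinates still carrying the factor. The bound on
  \<open>M\<close> is the dimension of the fully tensored map plus one for the coordinate in
  transit.\<close>

lemma gram_homotopic_untensor:
  fixes \<phi> :: "complex ^ 'n \<Rightarrow> complex ^ 'n" and f :: "complex ^ 'n \<Rightarrow> 'b \<Rightarrow> complex"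
  assumes f: "proper_on B f" and \<phi>: "proper_on UNIV (\<lambda>z. ($) (\<phi> z))" and B: "finite B"
    and "finite S" "S \<subseteq> B" "card S * CARD('n) + card (B - S) + 1 \<le> M"
  shows "gram_homotopic M
    (\<lambda>z w. \<Sum>b\<in>B. f z b * cnj (f w b) * (if b \<in> S then hinner (\<phi> z) (\<phi> w) else 1))
    (\<lambda>z w. vinner B (f z) (f w))"
  using assms(4-)
proof (induction S rule: finite_induct)
  case empty
  then show ?case
    using gram_homotopic_refl[OF B _ f, of M] by (simp add: vinner_def)
next
  case (insert s S)
  define n where "n = CARD('n)"
  have "n > 0" by (simp add: n_def)
  have "card (insert s (B - insert s S)) = Suc (card (B - insert s S))"
    using B by (intro card_insert_disjoint) auto
  moreover have "insert s (B - insert s S) = B - S" using insert.hyps insert.prems by auto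
  ultimately have "card (B - S) = Suc (card (B - insert s S))" by (simp only:)
  moreover have "n + card S * n + card (B - insert s S) + 1 \<le> M"
    using insert.prems(2) insert.hyps unfolding n_def by simp
  \<comment> \<open>The first inequality counts \<open>I\<close>, with n + 1 indices for
    \<open>s\<close>. The second one, for the induction hypothesis, follows because releasing
    \<open>s\<close> replaces n components by one.\<close>
  ultimately have card: "card S * n + n + card (B - insert s S) + 1 \<le> M"
    and card': "card S * n + card (B - S) + 1 \<le> M"
    using \<open>n > 0\<close> by linarith+
  \<comment> \<open>Only \<open>s\<close> moves; the rest of \<open>S\<close> stays fully tensored,
    and everything else is already released.\<close>
  define m where "m = (\<lambda>t b. if b = s then 1 - t else if b \<in> S then 1 else (0::real))"
  \<comment> \<open>Both summands are kept at \<open>s\<close> alone. Elsewhere \<open>m\<close> is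
    0 or 1, so one summand is identically zero and is dropped.\<close>
  define I :: "('b \<times> 'n option) set"
    where "I = S \<times> range Some \<union> {s} \<times> UNIV \<union> (B - insert s S) \<times> {None}"
  have I: "I \<subseteq> B \<times> UNIV" using insert.prems by (auto simp: I_def)
  have finI: "finite I" using insert.hyps B by (auto simp: I_def)
  have "card I \<le> card (S \<times> range (Some :: 'n \<Rightarrow> 'n option)) + card ({s} \<times> (UNIV :: 'n option set))
      + card ((B - insert s S) \<times> {None :: 'n option})"
    unfolding I_def by (intro order_trans[OF card_Un_le] add_right_mono card_Un_le)
  also have "\<dots> = card S * n + (n + 1) + card (B - insert s S)"
    by (simp add: card_cartesian_product card_image n_def)
  finally have cardI: "card I \<le> M" using card by simp
  have zero: "partial_tensor (m t) u v p = 0"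
    if "p \<in> B \<times> UNIV - I" for t u p and v :: "complex ^ 'n"
    using that by (auto simp: I_def m_def partial_tensor_def image_iff split: option.splits)
  have m01: "0 \<le> m t b \<and> m t b \<le> 1" if "t \<in> {0..1}" for t b
    using that by (auto simp: m_def)
  have gram: "vinner I (partial_tensor (m t) (f z) (\<phi> z)) (partial_tensor (m t) (f w) (\<phi> w)) =
      (\<Sum>b\<in>B. f z b * cnj (f w b) *
        (of_real (m t b) * hinner (\<phi> z) (\<phi> w) + of_real (1 - m t b)))" if "t \<in> {0..1}" for z w t
    using B m01[OF that] I zero by (intro vinner_partial_tensor) auto
  have "gram_homotopic M
      (\<lambda>z w. \<Sum>b\<in>B. f z b * cnj (f w b) * (if b \<in> insert s S then hinner (\<phi> z) (\<phi> w) else 1))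
      (\<lambda>z w. \<Sum>b\<in>B. f z b * cnj (f w b) * (if b \<in> S then hinner (\<phi> z) (\<phi> w) else 1))"
  proof (rule gram_homotopicI[where H = "\<lambda>z t. partial_tensor (m t) (f z) (\<phi> z)" and I = I])
    fix p assume "p \<in> I"
    then obtain b l where p: "p = (b, l)" "b \<in> B" using I by blast
    have m_cont: "continuous_on (ball (0 :: complex ^ 'n) 1 \<times> {0..1}) (\<lambda>p. m (snd p) b)"
      unfolding m_def by (cases "b = s") (auto intro!: continuous_intros)
    show "continuous_on (ball 0 1 \<times> {0..1})
        (\<lambda>q. partial_tensor (m (snd q)) (f (fst q)) (\<phi> (fst q)) p)"
      unfolding p partial_tensor_def
      by (cases l)
        (auto intro!: continuous_intros m_cont proper_on_imp_continuous_on[OF f p(2)]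
           proper_on_imp_continuous_on[OF \<phi>])
  next
    fix t :: real assume "t \<in> {0..1}"
    then show "proper_on I (\<lambda>z. partial_tensor (m t) (f z) (\<phi> z))"
      using m01 I zero by (intro proper_on_partial_tensor[OF f \<phi> B]) auto
  next
    fix z w :: "complex ^ 'n"
    show "vinner I (partial_tensor (m 0) (f z) (\<phi> z)) (partial_tensor (m 0) (f w) (\<phi> w)) =
      (\<Sum>b\<in>B. f z b * cnj (f w b) * (if b \<in> insert s S then hinner (\<phi> z) (\<phi> w) else 1))"
      by (subst gram, simp, intro sum.cong) (auto simp: m_def)
    show "vinner I (partial_tensor (m 1) (f z) (\<phi> z)) (partial_tensor (m 1) (f w) (\<phi> w)) =
      (\<Sum>b\<in>B. f z b * cnj (f w b) * (if b \<in> S then hinner (\<phi> z) (\<phi> w) else 1))"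
      using insert.hyps by (subst gram, simp, intro sum.cong) (auto simp: m_def)
  qed (use finI cardI in auto)
  moreover have "gram_homotopic M
      (\<lambda>z w. \<Sum>b\<in>B. f z b * cnj (f w b) * (if b \<in> S then hinner (\<phi> z) (\<phi> w) else 1))
      (\<lambda>z w. vinner B (f z) (f w))"
    using insert card' by (simp add: n_def)
  ultimately show ?case by (rule gram_homotopic_trans)
qed

subsection \<open>Orthonormal bases\<close>

text \<open>An indexed family rather than a set, so that it covers tensor bases and their images
  under an isometry.\<close>

definition orthonormal_on :: "'i set \<Rightarrow> 'q set \<Rightarrow> ('q \<Rightarrow> 'i \<Rightarrow> complex) \<Rightarrow> bool" where
  "orthonormal_on I Q v \<longleftrightarrow> (\<forall>p\<in>Q. \<forall>q\<in>Q. vinner I (v p) (v q) = (if p = q then 1 else 0))"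

lemma vinner_orthonormal_sum:
  assumes "orthonormal_on I Q v" "finite Q"
  shows "vinner I (\<Sum>q\<in>Q. vscale (a q) (v q)) (\<Sum>q\<in>Q. vscale (b q) (v q)) = vinner Q a b"
proof -
  have "vinner I (\<Sum>q\<in>Q. vscale (a q) (v q)) (\<Sum>q\<in>Q. vscale (b q) (v q)) =
      (\<Sum>q\<in>Q. \<Sum>p\<in>Q. a p * (cnj (b q) * vinner I (v p) (v q)))"
    by (simp add: vinner_sum vinner_linear sum_distrib_left mult.left_commute)
  also have "\<dots> = (\<Sum>q\<in>Q. \<Sum>p\<in>Q. if p = q then a p * cnj (b q) else 0)"
    using assms(1) by (intro sum.cong) (auto simp: orthonormal_on_def)
  also have "\<dots> = vinner Q a b"
    using assms(2) by (simp add: vinner_def)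
  finally show ?thesis .
qed

lemma orthogonal_residual:
  assumes "orthonormal_on I Q v" "finite Q" "p \<in> Q"
  shows "vinner I (x - (\<Sum>q\<in>Q. vscale (vinner I x (v q)) (v q))) (v p) = 0"
proof -
  have "(\<Sum>q\<in>Q. vinner I x (v q) * vinner I (v q) (v p)) = (\<Sum>q\<in>Q. if q = p then vinner I x (v q) else 0)"
    using assms by (intro sum.cong) (auto simp: orthonormal_on_def)
  then show ?thesis using assms by (simp add: vinner_linear vinner_sum)
qed

lemma norm_residual:
  assumes "orthonormal_on I Q v" "finite Q"
  shows "(vnorm I (x - (\<Sum>q\<in>Q. vscale (vinner I x (v q)) (v q))))\<^sup>2 =
    (vnorm I x)\<^sup>2 - (\<Sum>q\<in>Q. (cmod (vinner I x (v q)))\<^sup>2)" (is "(vnorm I ?y)\<^sup>2 = _")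
proof -
  have "vinner I ?y ?y = vinner I ?y x - (\<Sum>q\<in>Q. cnj (vinner I x (v q)) * vinner I ?y (v q))"
    by (simp only: vinner_linear(4,6) vinner_sum)
  also have "\<dots> = vinner I ?y x"
    using orthogonal_residual[OF assms] by simp
  also have "\<dots> = vinner I x x - (\<Sum>q\<in>Q. vinner I x (v q) * vinner I (v q) x)"
    by (simp only: vinner_linear(3,5) vinner_sum)
  also have "\<dots> = of_real ((vnorm I x)\<^sup>2 - (\<Sum>q\<in>Q. (cmod (vinner I x (v q)))\<^sup>2))"
    by (simp add: vinner_self vinner_commute[of I "v q" x for q] complex_norm_square[symmetric])
  finally show ?thesis unfolding vinner_self of_real_eq_iff .
qed

text \<open>Bessel's inequality for the coordinate vector at \<open>i\<close>, whose inner product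
  with \<open>v q\<close> is \<open>cnj (v q i)\<close>; the second part is the case of zero
  residual.\<close>

lemma orthonormal_coordinate_le:
  assumes "orthonormal_on I Q v" "finite Q" "finite I" "i \<in> I"
  shows "(\<Sum>q\<in>Q. (cmod (v q i))\<^sup>2) \<le> 1"
    and "(\<Sum>q\<in>Q. vscale (vinner I (\<lambda>k. if k = i then 1 else 0) (v q)) (v q)) = (\<lambda>k. if k = i then 1 else 0)
      \<Longrightarrow> (\<Sum>q\<in>Q. (cmod (v q i))\<^sup>2) = 1"
proof -
  let ?x = "\<lambda>k. if k = i then 1 else 0 :: complex"
  have ip: "vinner I ?x y = cnj (y i)" for y
    using assms(3,4) by (simp add: vinner_def if_distrib[of "\<lambda>c. c * _"] cong: if_cong)
  have "(vnorm I ?x)\<^sup>2 = (\<Sum>k\<in>I. if k = i then 1 else 0)"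
    unfolding vnorm_sq by (intro sum.cong) auto
  then have "(vnorm I ?x)\<^sup>2 = 1" using assms(3,4) by simp
  then have eq: "(vnorm I (?x - (\<Sum>q\<in>Q. vscale (vinner I ?x (v q)) (v q))))\<^sup>2 = 1 - (\<Sum>q\<in>Q. (cmod (v q i))\<^sup>2)"
    using norm_residual[OF assms(1,2), of ?x] by (simp add: ip)
  then show "(\<Sum>q\<in>Q. (cmod (v q i))\<^sup>2) \<le> 1"
    using zero_le_power2[of "vnorm I (?x - (\<Sum>q\<in>Q. vscale (vinner I ?x (v q)) (v q)))"] by linarith
  assume "(\<Sum>q\<in>Q. vscale (vinner I ?x (v q)) (v q)) = ?x"
  then have "(vnorm I (?x - (\<Sum>q\<in>Q. vscale (vinner I ?x (v q)) (v q))))\<^sup>2 = 0"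
    unfolding vnorm_sq by simp
  with eq show "(\<Sum>q\<in>Q. (cmod (v q i))\<^sup>2) = 1" by linarith
qed

text \<open>Double counting: each vector has squared length 1. Bounding the sums over
  \<open>Q\<close> at each coordinate by 1 then limits \<open>card Q\<close> by
  \<open>card I\<close>, and a basis attains equality.\<close>

lemma card_eq_coordinate_sum:
  assumes "orthonormal_on I Q v"
  shows "real (card Q) = (\<Sum>i\<in>I. \<Sum>q\<in>Q. (cmod (v q i))\<^sup>2)"
proof -
  have "(\<Sum>i\<in>I. (cmod (v q i))\<^sup>2) = 1" if "q \<in> Q" for q
  proof -
    have "complex_of_real ((vnorm I (v q))\<^sup>2) = of_real 1"
      using assms that unfolding orthonormal_on_def vinner_self[symmetric] by simp
    then show ?thesis unfolding of_real_eq_iff vnorm_sq .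
  qed
  then have "real (card Q) = (\<Sum>q\<in>Q. \<Sum>i\<in>I. (cmod (v q i))\<^sup>2)" by simp
  also have "\<dots> = (\<Sum>i\<in>I. \<Sum>q\<in>Q. (cmod (v q i))\<^sup>2)" by (rule sum.swap)
  finally show ?thesis .
qed

lemma card_orthonormal_le:
  assumes "orthonormal_on I Q v" "finite Q" "finite I"
  shows "card Q \<le> card I"
proof -
  have "real (card Q) \<le> (\<Sum>i\<in>I. 1)"
    unfolding card_eq_coordinate_sum[OF assms(1)]
    by (intro sum_mono orthonormal_coordinate_le(1)[OF assms])
  then show ?thesis by simp
qed

lemma card_orthonormal_basis:
  assumes "orthonormal_on I Q v" "finite Q" "finite I"
    and "\<And>x. x \<in> vecs I \<Longrightarrow> (\<Sum>q\<in>Q. vscale (vinner I x (v q)) (v q)) = x"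
  shows "card Q = card I"
proof -
  have "real (card Q) = (\<Sum>i\<in>I. 1)"
    unfolding card_eq_coordinate_sum[OF assms(1)]
    by (intro sum.cong refl orthonormal_coordinate_le(2)[OF assms(1-3)] assms(4)) (auto simp: vecs_def)
  then show ?thesis by simp
qed

text \<open>An orthonormal subset of \<open>V\<close> of largest size spans \<open>V\<close>: a
  nonzero residual, normalized, would enlarge it.\<close>

lemma orthonormal_basis_exists:
  fixes V :: "('i \<Rightarrow> complex) set"
  assumes "finite I" "cvec.subspace V" "V \<subseteq> vecs I"
  obtains S where "finite S" "S \<subseteq> V" "orthonormal_on I S (\<lambda>s. s)"
    "\<And>x. x \<in> V \<Longrightarrow> (\<Sum>s\<in>S. vscale (vinner I x s) s) = x"
proof -
  let ?P = "\<lambda>S. finite S \<and> S \<subseteq> V \<and> orthonormal_on I S (\<lambda>s. s)"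
  have "?P {}" by (simp add: orthonormal_on_def)
  moreover have "\<forall>S. ?P S \<longrightarrow> card S \<le> card I"
    using card_orthonormal_le assms(1) by blast
  ultimately have "\<exists>S. ?P S \<and> (\<forall>S'. ?P S' \<longrightarrow> card S' \<le> card S)"
    by (intro Lattices_Big.ex_has_greatest_nat[of ?P "{}" card "Suc (card I)"]) (auto simp: less_Suc_eq_le)
  then obtain S where S: "finite S" "S \<subseteq> V" "orthonormal_on I S (\<lambda>s. s)"
    and max: "\<And>S'. ?P S' \<Longrightarrow> card S' \<le> card S" by blast
  have "(\<Sum>s\<in>S. vscale (vinner I x s) s) = x" if x: "x \<in> V" for x
  proof (rule ccontr)
    define y where "y = x - (\<Sum>s\<in>S. vscale (vinner I x s) s)"
    assume "(\<Sum>s\<in>S. vscale (vinner I x s) s) \<noteq> x"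
    then have "y \<noteq> 0" by (auto simp: y_def)
    have "y \<in> V" unfolding y_def
      using x S(2) by (intro cvec.subspace_diff cvec.subspace_sum cvec.subspace_scale assms(2)) auto
    define r where "r = vnorm I y"
    have "vinner I y y \<noteq> 0"
      using vinner_eq_zeroD[OF assms(1)] \<open>y \<in> V\<close> \<open>y \<noteq> 0\<close> assms(3) by blast
    then have "r \<noteq> 0" by (simp add: vinner_self r_def)
    define u where "u = vscale (1 / of_real r) y"
    have uu: "vinner I u u = 1"
    proof -
      have "vinner I y y = of_real (r\<^sup>2)" by (simp add: vinner_self r_def)
      then show ?thesis
        unfolding u_def vinner_linear using \<open>r \<noteq> 0\<close> by (simp add: power2_eq_square)
    qed
    have us: "vinner I u s = 0" "vinner I s u = 0" if "s \<in> S" for s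
      using orthogonal_residual[OF S(3,1) that, of x] vinner_commute[of I s u]
      by (simp_all add: u_def vinner_linear y_def)
    have "u \<notin> S" using uu us(1)[of u] by auto
    have "?P (insert u S)"
      using S uu us \<open>y \<in> V\<close> cvec.subspace_scale[OF assms(2)]
      by (auto simp: orthonormal_on_def u_def[symmetric]) (auto simp: u_def)
    then show False using max[of "insert u S"] S(1) \<open>u \<notin> S\<close> by simp
  qed
  with S show thesis by (rule that)
qed

text \<open>The hypothesis compares the cross terms of |x + c y|^2. The values 1 and
  \<open>\<i>\<close> of c determine a + b and b - a.\<close>

lemma complex_polarization:
  assumes "\<And>c. cnj c * a + c * b = cnj c * a' + c * b'"
  shows "a = a'"
proof -
  have "\<i> * (b - a) = \<i> * (b' - a')"
    using assms[of \<i>] by (simp add: algebra_simps)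
  then have "b - a = b' - a'" by simp
  moreover have "a + b = a' + b'" using assms[of 1] by simp
  ultimately show ?thesis by algebra
qed

lemma linear_isometry_on_vinner:
  assumes j: "linear_isometry_on W I J j" and W: "cvec.subspace W" and x: "x \<in> W" "y \<in> W"
  shows "vinner J (j x) (j y) = vinner I x y"
proof -
  have norm: "vinner J (j u) (j u) = vinner I u u" if "u \<in> W" for u
    using j that by (simp add: linear_isometry_on_def vinner_self)
  have "vinner J (j x + vscale c (j y)) (j x + vscale c (j y)) = vinner I (x + vscale c y) (x + vscale c y)" for c
  proof -
    have cy: "vscale c y \<in> W" using W x by (simp add: cvec.subspace_scale)
    then have "j (x + vscale c y) = j x + vscale c (j y)"
      using j x by (simp add: linear_isometry_on_def)
    moreover have "x + vscale c y \<in> W" using W x cy by (simp add: cvec.subspace_add)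
    ultimately show ?thesis using norm[of "x + vscale c y"] by simp
  qed
  then have *: "cnj c * vinner J (j x) (j y) + c * vinner J (j y) (j x) =
      cnj c * vinner I x y + c * vinner I y x" for c
    by (simp add: vinner_linear norm x algebra_simps)
  show ?thesis by (rule complex_polarization) (rule *)
qed

lemma linear_isometry_on_sum:
  assumes j: "linear_isometry_on W I J j" and W: "cvec.subspace W"
    and "finite Q" "\<And>q. q \<in> Q \<Longrightarrow> e q \<in> W"
  shows "j (\<Sum>q\<in>Q. vscale (h q) (e q)) = (\<Sum>q\<in>Q. vscale (h q) (j (e q)))"
  using assms(3,4)
proof (induction Q rule: finite_induct)
  case empty
  have "0 \<in> W" using W by (rule cvec.subspace_0)
  moreover have "vscale 0 u = 0" for u :: "'x \<Rightarrow> complex" by (simp add: vscale_def zero_fun_def)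
  ultimately have "j 0 = 0" using j by (metis linear_isometry_on_def)
  then show ?case unfolding sum.empty .
next
  case (insert q Q)
  have "vscale (h q) (e q) \<in> W" "(\<Sum>q\<in>Q. vscale (h q) (e q)) \<in> W"
    using W insert.prems by (auto intro!: cvec.subspace_scale cvec.subspace_sum)
  moreover have "e q \<in> W" using insert.prems by simp
  ultimately have "j (vscale (h q) (e q) + (\<Sum>q\<in>Q. vscale (h q) (e q))) =
      vscale (h q) (j (e q)) + j (\<Sum>q\<in>Q. vscale (h q) (e q))"
    using j unfolding linear_isometry_on_def by metis
  moreover have "j (\<Sum>q\<in>Q. vscale (h q) (e q)) = (\<Sum>q\<in>Q. vscale (h q) (j (e q)))"
    using insert.IH insert.prems by blast
  ultimately show ?case by (simp only: sum.insert[OF insert.hyps])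
qed

section \<open>Direct sums, tensor products and bases adapted to a projection\<close>

lemma vinner_dsum:
  assumes "finite X" "finite Y"
  shows "vinner (X <+> Y) (dsum a b) (dsum c d) = vinner X a c + vinner Y b d"
  using assms by (simp add: vinner_def dsum_def sum.Plus)

lemma vinner_tensor: "vinner (X \<times> UNIV) (tensor u v) (tensor u' v') = vinner X u u' * hinner v v'"
  by (simp add: vinner_def tensor_def sum_product sum.cartesian_product case_prod_beta mult_ac)

lemma hinner_axis: "hinner (axis l 1) (axis m 1 :: complex ^ 'n) = (if l = m then 1 else 0)"
proof -
  have "hinner (axis l 1) (axis m 1 :: complex ^ 'n) = (\<Sum>i\<in>UNIV. if i = l then if l = m then 1 else 0 else 0)"
    unfolding vinner_def by (intro sum.cong) (auto simp: axis_def)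
  then show ?thesis by simp
qed

lemma orth_compl_subspace: "cvec.subspace (orth_compl N A)"
  by (rule cvec.subspaceI) (auto simp: orth_compl_def vecs_closed vinner_linear)

lemma orth_proj_bases:
  assumes A: "A \<subseteq> vecs {..<N}" "cvec.subspace A" and \<pi>: "is_orth_proj N A \<pi>"
  obtains S T where "finite S" "finite T" "S \<subseteq> A" "T \<subseteq> orth_compl N A" "S \<inter> T = {}"
    "orthonormal_on {..<N} (S \<union> T) (\<lambda>b. b)" "card S + card T = N"
    "\<And>x. x \<in> vecs {..<N} \<Longrightarrow> \<pi> x = (\<Sum>s\<in>S. vscale (vinner {..<N} x s) s)"
    "\<And>x. x \<in> vecs {..<N} \<Longrightarrow> x - \<pi> x = (\<Sum>t\<in>T. vscale (vinner {..<N} x t) t)"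
proof -
  let ?O = "orth_compl N A"
  obtain S where S: "finite S" "S \<subseteq> A" "orthonormal_on {..<N} S (\<lambda>s. s)"
    "\<And>x. x \<in> A \<Longrightarrow> (\<Sum>s\<in>S. vscale (vinner {..<N} x s) s) = x"
    using orthonormal_basis_exists[of "{..<N}" A] A by blast
  obtain T where T: "finite T" "T \<subseteq> ?O" "orthonormal_on {..<N} T (\<lambda>s. s)"
    "\<And>x. x \<in> ?O \<Longrightarrow> (\<Sum>s\<in>T. vscale (vinner {..<N} x s) s) = x"
    using orthonormal_basis_exists[of "{..<N}" ?O] orth_compl_subspace[of N A]
    by (auto simp: orth_compl_def)
  have orth: "vinner {..<N} y x = 0" "vinner {..<N} x y = 0" if "x \<in> A" "y \<in> ?O" for x y
    using that vinner_commute[of "{..<N}" x y] by (auto simp: orth_compl_def)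
  have disj: "S \<inter> T = {}"
  proof -
    have False if "b \<in> S" "b \<in> T" for b
    proof -
      have "vinner {..<N} b b = 1" using S(3) that(1) by (simp add: orthonormal_on_def)
      moreover have "vinner {..<N} b b = 0" using orth(1)[of b b] S(2) T(2) that by blast
      ultimately show False by simp
    qed
    then show ?thesis by blast
  qed
  have on: "orthonormal_on {..<N} (S \<union> T) (\<lambda>b. b)"
    unfolding orthonormal_on_def
  proof (intro ballI)
    fix p q assume "p \<in> S \<union> T" "q \<in> S \<union> T"
    then consider "p \<in> S" "q \<in> S" | "p \<in> T" "q \<in> T" | "p \<in> S" "q \<in> T" | "p \<in> T" "q \<in> S" by blast
    then show "vinner {..<N} p q = (if p = q then 1 else 0)"
    proof cases
      case 1 then show ?thesis using S(3) by (simp add: orthonormal_on_def)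
    next
      case 2 then show ?thesis using T(3) by (simp add: orthonormal_on_def)
    next
      case 3 then show ?thesis using orth[of p q] S(2) T(2) disj by auto
    next
      case 4 then show ?thesis using orth[of q p] S(2) T(2) disj by auto
    qed
  qed
  have \<pi>A: "\<pi> x \<in> A" "x - \<pi> x \<in> ?O" if "x \<in> vecs {..<N}" for x
    using \<pi> that by (auto simp: is_orth_proj_def)
  \<comment> \<open>The coefficients can be taken from \<open>x\<close> in place of
    \<open>\<pi> x\<close>, since the difference is orthogonal to \<open>S\<close>.\<close>
  have pS: "\<pi> x = (\<Sum>s\<in>S. vscale (vinner {..<N} x s) s)" if x: "x \<in> vecs {..<N}" for x
  proof -
    have "vinner {..<N} (\<pi> x) s = vinner {..<N} x s" if "s \<in> S" for s
      using orth(1)[of s "x - \<pi> x"] \<pi>A[OF x] S(2) that by (auto simp: vinner_linear)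
    then show ?thesis using S(4)[OF \<pi>A(1)[OF x]] by simp
  qed
  have pT: "x - \<pi> x = (\<Sum>t\<in>T. vscale (vinner {..<N} x t) t)" if x: "x \<in> vecs {..<N}" for x
  proof -
    have "vinner {..<N} (x - \<pi> x) t = vinner {..<N} x t" if "t \<in> T" for t
      using orth(2)[of "\<pi> x" t] \<pi>A[OF x] T(2) that by (auto simp: vinner_linear)
    then show ?thesis using T(4)[OF \<pi>A(2)[OF x]] by simp
  qed
  have "(\<Sum>b\<in>S \<union> T. vscale (vinner {..<N} x b) b) = x" if "x \<in> vecs {..<N}" for x
    using pS[OF that] pT[OF that] S(1) T(1) disj
    by (simp add: sum.union_disjoint flip: diff_eq_eq) (metis add_diff_cancel_left' diff_add_cancel add.commute)
  then have "card (S \<union> T) = card {..<N}"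
    using S(1) T(1) by (intro card_orthonormal_basis[OF on]) auto
  then have "card S + card T = N"
    using S(1) T(1) disj by (simp add: card_Un_disjoint)
  then show thesis
    using that[OF S(1) T(1) S(2) T(2) disj on _ pS pT] by blast
qed

subsection \<open>Automorphisms of the ball\<close>

lemma hinner_linear:
  fixes x y z :: "complex ^ 'n"
  shows "hinner (x + y) z = hinner x z + hinner y z" "hinner z (x + y) = hinner z x + hinner z y"
    "hinner (x - y) z = hinner x z - hinner y z" "hinner z (x - y) = hinner z x - hinner z y"
    "hinner (c *s x) z = c * hinner x z" "hinner z (c *s x) = cnj c * hinner z x"
    "hinner 0 z = 0" "hinner z 0 = 0"
    "hinner (- x) z = - hinner x z" "hinner z (- x) = - hinner z x"
  by (simp_all add: vinner_def sum.distrib sum_subtractf sum_distrib_left sum_negf algebra_simps)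

lemma hinner_self: "hinner z z = of_real ((norm z)\<^sup>2)"
  by (simp add: vinner_self norm_eq_vnorm)

lemma hinner_Cauchy_Schwarz: "cmod (hinner z w) \<le> norm z * norm w"
  using vinner_Cauchy_Schwarz by (simp add: norm_eq_vnorm)

lemma norm_vector_scalar: "norm (c *s z) = cmod c * norm z" for z :: "complex ^ 'n"
proof -
  have "complex_of_real ((norm (c *s z))\<^sup>2) = complex_of_real ((cmod c * norm z)\<^sup>2)"
    unfolding hinner_self[symmetric] hinner_linear
    unfolding hinner_self power_mult_distrib of_real_mult complex_norm_square by (simp add: mult_ac)
  then have "(norm (c *s z))\<^sup>2 = (cmod c * norm z)\<^sup>2" unfolding of_real_eq_iff .
  then show ?thesis by simp
qed

lemma holo_on_imp_continuous_on_vec: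
  fixes f :: "complex ^ 'n \<Rightarrow> complex ^ 'm"
  assumes "\<And>i. holo_on S (\<lambda>z. f z $ i)"
  shows "continuous_on S f"
  using continuous_on_vec_lambda[of S "\<lambda>i z. f z $ i", OF holo_on_imp_continuous_on[OF assms]] by simp

text \<open>The inverse is continuous, so its norm attains a maximum below 1 on each smaller closed
  ball; points beyond that maximum are sent outside the smaller ball.\<close>

lemma ball_automorphism_proper:
  fixes \<phi> :: "complex ^ 'n \<Rightarrow> complex ^ 'n"
  assumes "ball_automorphism \<phi>"
  shows "proper_on UNIV (\<lambda>z. ($) (\<phi> z))"
  unfolding proper_on_def norm_eq_vnorm[symmetric]
proof (intro conjI ballI allI impI)
  let ?\<psi> = "the_inv_into (ball 0 1) \<phi>"
  have bij: "bij_betw \<phi> (ball 0 1) (ball 0 1)" using assms by (simp add: ball_automorphism_def)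
  show "holo_on (ball 0 1) (\<lambda>z. \<phi> z $ i)" for i using assms by (simp add: ball_automorphism_def)
  show "(norm (\<phi> z))\<^sup>2 < 1" if "z \<in> ball 0 1" for z
    using bij_betwE[OF bij] that by (simp add: abs_square_less_1)
  fix e :: real assume "e > 0"
  \<comment> \<open>The \<open>max\<close> covers \<open>e\<close> above 1.\<close>
  define \<rho> where "\<rho> = sqrt (max 0 (1 - e))"
  have "0 \<le> \<rho>" "\<rho> < 1" using \<open>e > 0\<close> by (auto simp: \<rho>_def)
  have "continuous_on (ball 0 1) ?\<psi>"
    using assms by (intro holo_on_imp_continuous_on_vec) (simp add: ball_automorphism_def)
  then have "continuous_on (cball 0 \<rho>) ?\<psi>"
    using \<open>\<rho> < 1\<close> by (elim continuous_on_subset) auto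
  then have "continuous_on (cball 0 \<rho>) (\<lambda>w. norm (?\<psi> w))" by (rule continuous_on_norm)
  then obtain w where w: "w \<in> cball 0 \<rho>" "\<And>v. v \<in> cball 0 \<rho> \<Longrightarrow> norm (?\<psi> v) \<le> norm (?\<psi> w)"
    using continuous_attains_sup[OF compact_cball] \<open>0 \<le> \<rho>\<close> by (metis cball_eq_empty not_le)
  have "w \<in> ball 0 1" using w(1) \<open>\<rho> < 1\<close> by simp
  then have "?\<psi> w \<in> ball 0 1"
    using bij_betwE[OF bij_betw_the_inv_into[OF bij]] by blast
  moreover have "1 - e < (norm (\<phi> z))\<^sup>2" if z: "z \<in> ball 0 1" "norm (?\<psi> w) < norm z" for z
  proof -
    have "?\<psi> (\<phi> z) = z" using bij z(1) by (simp add: bij_betw_def the_inv_into_f_f)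
    then have "\<rho> < norm (\<phi> z)" using w(2)[of "\<phi> z"] z(2) by force
    then have "\<rho>\<^sup>2 < (norm (\<phi> z))\<^sup>2" using \<open>0 \<le> \<rho>\<close> by (intro power_strict_mono) auto
    then show ?thesis by (simp add: \<rho>_def)
  qed
  ultimately show "\<exists>r<1. \<forall>z\<in>ball 0 1. r < norm z \<longrightarrow> 1 - e < (norm (\<phi> z))\<^sup>2"
    by (intro exI[of _ "norm (?\<psi> w)"]) auto
qed

section \<open>Involutions exchanging the origin and a point\<close>

definition defect :: "complex ^ 'n \<Rightarrow> complex" where
  "defect a = of_real (sqrt (1 - (norm a)\<^sup>2))"

text \<open>The classical (a - Pz - s(z - Pz)) / (1 - <z,a>), with P the projection onto the line of
  \<open>a\<close> and s the defect. Since |a|^2 = (1 - s)(1 + s), the terms in Pz combine to -<z,a>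
  a / (1 + s). This form has no division by |a|^2, so it covers a = 0 and is visibly continuous in
  \<open>a\<close>.\<close>

definition ball_involution :: "complex ^ 'n \<Rightarrow> complex ^ 'n \<Rightarrow> complex ^ 'n" where
  "ball_involution a z = inverse (1 - hinner z a) *s
     ((1 - hinner z a / (1 + defect a)) *s a - defect a *s z)"

lemma defect_nonzero:
  assumes "norm a < 1"
  shows "defect a \<noteq> 0" "1 + defect a \<noteq> 0"
proof -
  have s: "0 < sqrt (1 - (norm a)\<^sup>2)" using assms by (simp add: abs_square_less_1)
  then show "defect a \<noteq> 0" by (simp add: defect_def)
  have "1 + defect a = of_real (1 + sqrt (1 - (norm a)\<^sup>2))" by (simp add: defect_def)
  then show "1 + defect a \<noteq> 0" using s by (simp only: of_real_eq_0_iff)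
qed

lemma defect_square:
  assumes "norm a < 1"
  shows "hinner a a = 1 - (defect a)\<^sup>2"
proof -
  have "0 \<le> 1 - (norm a)\<^sup>2" using assms by (simp add: abs_square_le_1)
  then show ?thesis by (simp add: hinner_self defect_def flip: of_real_power)
qed

lemma ball_involution_denominator:
  assumes "norm a < 1" "norm z < 1"
  shows "1 - hinner z a \<noteq> 0"
proof
  assume "1 - hinner z a = 0"
  then have "1 \<le> norm z * norm a" using hinner_Cauchy_Schwarz[of z a] by simp
  moreover have "norm z * norm a < 1 * 1" using assms by (intro mult_strict_mono') auto
  ultimately show False by simp
qed

text \<open>Writing w for the image of z, the identity behind it is 1 - |w|^2 = (1 - |a|^2)(1 -
  |z|^2) / |1 - <z,a>|^2.\<close>

lemma ball_involution_norm:
  assumes "norm a < 1" "norm z < 1"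
  shows "norm (ball_involution a z) < 1"
proof -
  define s p q where "s = defect a" and "p = hinner z a" and "q = p / (1 + s)"
  define u where "u = (1 - q) *s a - s *s z"
  have s: "s \<noteq> 0" "1 + s \<noteq> 0" "cnj s = s" "hinner a a = 1 - s\<^sup>2"
    using defect_nonzero[OF assms(1)] defect_square[OF assms(1)] by (auto simp: s_def defect_def)
  have p: "hinner z a = p" "hinner a z = cnj p"
    using vinner_commute[of UNIV "($) a" "($) z"] by (auto simp: p_def)
  \<comment> \<open>Eliminating \<open>p\<close> in favour of \<open>q\<close> clears the
    denominator 1 + s and leaves a polynomial identity.\<close>
  have pq: "p = (1 + s) * q" "cnj p = (1 + s) * cnj q" using s(2,3) by (auto simp: q_def)
  have "hinner u u = (1 - q) * (1 - cnj q) * (1 - s\<^sup>2) - s * (1 - q) * cnj p - s * (1 - cnj q) * p + s\<^sup>2 * hinner z z"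
    by (simp add: u_def hinner_linear p s algebra_simps power2_eq_square)
  also have "\<dots> = (1 - p) * (1 - cnj p) - s\<^sup>2 * (1 - hinner z z)"
    unfolding pq(2) unfolding pq(1) by (simp add: algebra_simps power2_eq_square)
  finally have uu: "hinner u u = (1 - p) * (1 - cnj p) - s\<^sup>2 * (1 - hinner z z)" .
  have s2: "s\<^sup>2 = of_real (1 - (norm a)\<^sup>2)" using s(4) by (simp add: hinner_self)
  have d2: "(1 - p) * (1 - cnj p) = of_real ((cmod (1 - p))\<^sup>2)"
    by (simp only: complex_norm_square complex_cnj_diff complex_cnj_one)
  have "complex_of_real ((norm u)\<^sup>2) = of_real ((cmod (1 - p))\<^sup>2 - (1 - (norm a)\<^sup>2) * (1 - (norm z)\<^sup>2))"
    using uu unfolding s2 d2 hinner_self by simp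
  then have "(norm u)\<^sup>2 = (cmod (1 - p))\<^sup>2 - (1 - (norm a)\<^sup>2) * (1 - (norm z)\<^sup>2)"
    by (simp only: of_real_eq_iff)
  moreover have "0 < (1 - (norm a)\<^sup>2) * (1 - (norm z)\<^sup>2)"
    using assms by (intro mult_pos_pos) (auto simp: abs_square_less_1)
  ultimately have "(norm u)\<^sup>2 < (cmod (1 - p))\<^sup>2" by linarith
  then have "norm u < cmod (1 - p)" by (rule power_less_imp_less_base) simp
  moreover have "ball_involution a z = inverse (1 - p) *s u"
    by (simp add: ball_involution_def u_def q_def p_def s_def)
  moreover have "1 - p \<noteq> 0" using ball_involution_denominator[OF assms] by (simp add: p_def)
  ultimately show ?thesis
    by (simp only: norm_vector_scalar norm_inverse) (simp add: field_simps)
qed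

lemma ball_involution_involutive:
  assumes "norm a < 1" "norm z < 1"
  shows "ball_involution a (ball_involution a z) = z"
proof -
  define s p q where "s = defect a" and "p = hinner z a" and "q = p / (1 + s)"
  define w where "w = ball_involution a z"
  have s: "s \<noteq> 0" "1 + s \<noteq> 0" "hinner a a = 1 - s\<^sup>2"
    using defect_nonzero[OF assms(1)] defect_square[OF assms(1)] by (auto simp: s_def)
  have pq: "p = (1 + s) * q" using s(2) by (auto simp: q_def)
  have d: "1 - p \<noteq> 0" using ball_involution_denominator[OF assms] by (simp add: p_def)
  have w: "w = inverse (1 - p) *s ((1 - q) *s a - s *s z)"
    by (simp add: w_def ball_involution_def q_def p_def s_def)
  have "hinner w a = inverse (1 - p) * ((1 - q) * (1 - s\<^sup>2) - s * p)"
    by (simp only: w hinner_linear s p_def[symmetric])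
  then have "(1 - p) * hinner w a = (1 - q) * (1 - s\<^sup>2) - s * p"
    using d by simp
  then have wa: "(1 - p) * hinner w a = (1 - s\<^sup>2) - p"
    unfolding pq by (simp add: algebra_simps power2_eq_square)
  \<comment> \<open>The two denominators multiply to \<open>s\<^sup>2\<close>, which is what makes
    the second application undo the first.\<close>
  then have d': "(1 - p) * (1 - hinner w a) = s\<^sup>2" by (simp add: algebra_simps)
  have "1 - hinner w a = s\<^sup>2 / (1 - p)" using d d' by (simp add: field_simps)
  then have inv: "inverse (1 - hinner w a) = (1 - p) / s\<^sup>2" by simp
  have "(1 - p) * (1 + s) * (1 - hinner w a / (1 + s)) = (1 - p) * (1 + s) - (1 - p) * hinner w a"
    using s(2) by (simp add: field_simps)
  also have "\<dots> = (1 + s) * (s * (1 - q))"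
    unfolding wa unfolding pq by (simp add: algebra_simps power2_eq_square)
  \<comment> \<open>With this coefficient the multiples of \<open>a\<close> cancel and only
    \<open>s\<^sup>2\<close> times \<open>z\<close> remains.\<close>
  finally have coef: "(1 - p) * (1 - hinner w a / (1 + s)) = s * (1 - q)"
    using s(2) by (simp add: mult.assoc mult.left_commute[of _ "1 + s"])
  have "ball_involution a w = ((1 - p) / s\<^sup>2) *s ((1 - hinner w a / (1 + s)) *s a - s *s w)"
    by (simp add: ball_involution_def inv s_def[symmetric])
  also have "\<dots> = inverse (s\<^sup>2) *s (((1 - p) * (1 - hinner w a / (1 + s))) *s a - s *s ((1 - p) *s w))"
    by (simp add: vec_eq_iff divide_inverse algebra_simps)
  also have "(1 - p) *s w = (1 - q) *s a - s *s z"
    using d by (simp only: w vector_smult_assoc right_inverse[OF d] vector_smult_lid)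
  also have "inverse (s\<^sup>2) *s (((1 - p) * (1 - hinner w a / (1 + s))) *s a - s *s ((1 - q) *s a - s *s z)) = z"
    unfolding coef using s(1) by (simp add: vec_eq_iff field_simps power2_eq_square)
  finally show ?thesis by (simp add: w_def)
qed

lemma ball_involution_0: "ball_involution a 0 = a"
  by (simp add: ball_involution_def hinner_linear)

lemma ball_involution_self:
  assumes "norm a < 1"
  shows "ball_involution a a = 0"
  using ball_involution_involutive[of a 0] assms by (simp add: ball_involution_0)

text \<open>The deformation of \<open>a\<close> to 0 ends at this sign change, which is invisible in
  the Gram kernel.\<close>

lemma ball_involution_of_0: "ball_involution 0 z = - z"
  by (simp add: ball_involution_def hinner_linear defect_def vec_eq_iff)

lemma ball_involution_component:
  "ball_involution a z $ i = inverse (1 - (\<Sum>j\<in>UNIV. z $ j * cnj (a $ j))) *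
     ((1 - (\<Sum>j\<in>UNIV. z $ j * cnj (a $ j)) / (1 + defect a)) * a $ i - defect a * z $ i)"
  by (simp only: ball_involution_def vinner_def vector_smult_component vector_minus_component)

lemma holo_on_ball_involution:
  assumes "norm a < 1"
  shows "holo_on (ball 0 1) (\<lambda>z. ball_involution a z $ i)"
proof -
  have "1 - (\<Sum>j\<in>UNIV. z $ j * cnj (a $ j)) \<noteq> 0" if "z \<in> ball 0 1" for z
    using ball_involution_denominator[OF assms, of z] that by (simp add: vinner_def)
  then show ?thesis
    unfolding ball_involution_component using defect_nonzero[OF assms]
    by (intro holo_on_intros holo_on_inverse) auto
qed

lemma ball_involution_automorphism:
  assumes "norm a < 1"
  shows "ball_automorphism (ball_involution a)"
proof -
  have bij: "bij_betw (ball_involution a) (ball 0 1) (ball 0 1)"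
    using ball_involution_norm[OF assms] ball_involution_involutive[OF assms]
    by (intro bij_betw_byWitness[where f' = "ball_involution a"]) auto
  have "the_inv_into (ball 0 1) (ball_involution a) z = ball_involution a z" if "z \<in> ball 0 1" for z
    using bij ball_involution_norm[OF assms] ball_involution_involutive[OF assms] that
    by (intro the_inv_into_f_eq) (auto simp: bij_betw_def)
  then have "holo_on (ball 0 1) (\<lambda>z. the_inv_into (ball 0 1) (ball_involution a) z $ i)" for i
    using holo_on_ball_involution[OF assms, of i] by (subst holo_on_cong[where g = "\<lambda>z. ball_involution a z $ i"]) auto
  then show ?thesis
    using bij holo_on_ball_involution[OF assms] by (simp add: ball_automorphism_def)
qed

section \<open>The Schwarz lemma on complex lines through the origin\<close>

lemma holomorphic_on_hinner_line:
  fixes f :: "complex ^ 'n \<Rightarrow> complex ^ 'm"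
  assumes "\<And>i. holo_on (ball 0 1) (\<lambda>z. f z $ i)" "norm u = 1"
  shows "(\<lambda>\<zeta>. hinner (f (\<zeta> *s u)) v) holomorphic_on ball 0 1"
proof -
  have h: "holo_on (ball 0 1) (\<lambda>z. hinner (f z) v)"
    unfolding vinner_def by (intro holo_on_intros assms)
  have "\<exists>D. ((\<lambda>\<zeta>. hinner (f (\<zeta> *s u)) v) has_field_derivative D) (at \<zeta>)" if "\<zeta> \<in> ball 0 1" for \<zeta>
  proof -
    have mem: "\<zeta> *s u \<in> ball 0 1" using that assms(2) by (simp add: norm_vector_scalar)
    then obtain D where "((\<lambda>z. hinner (f z) v) has_derivative D) (at (\<zeta> *s u))"
      using h unfolding holo_on_def by blast
    from holo_on_line[OF h mem this] show ?thesis by blast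
  qed
  then show ?thesis by (auto simp: holomorphic_on_open)
qed

text \<open>Restricting to the line of \<open>u\<close> and pairing with \<open>v\<close> gives a
  self-map of the disc fixing 0, to which the one-variable lemma applies. The second part is its
  equality case: one nonzero fixed point forces the identity.\<close>

lemma Schwarz_Lemma_ball:
  fixes f :: "complex ^ 'n \<Rightarrow> complex ^ 'm"
  assumes hol: "\<And>i. holo_on (ball 0 1) (\<lambda>z. f z $ i)" and f: "f ` ball 0 1 \<subseteq> ball 0 1" and "f 0 = 0"
    and u: "norm u = 1" and v: "norm v = 1"
  defines "g \<equiv> \<lambda>\<zeta>. hinner (f (\<zeta> *s u)) v"
  assumes \<xi>: "norm \<xi> < 1"
  shows "norm (g \<xi>) \<le> norm \<xi>"
    and "\<xi> \<noteq> 0 \<Longrightarrow> g \<xi> = \<xi> \<Longrightarrow> norm \<zeta> < 1 \<Longrightarrow> g \<zeta> = \<zeta>"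
proof -
  have g: "g holomorphic_on ball 0 1" "g 0 = 0"
    using holomorphic_on_hinner_line[OF hol u] \<open>f 0 = 0\<close> by (auto simp: g_def hinner_linear)
  have lt: "norm (g z) < 1" if "norm z < 1" for z
  proof -
    have "z *s u \<in> ball 0 1" using that u by (simp add: norm_vector_scalar)
    then have "f (z *s u) \<in> ball 0 1" using f by blast
    then show ?thesis
      using hinner_Cauchy_Schwarz[of "f (z *s u)" v] v by (simp add: g_def)
  qed
  show "norm (g \<xi>) \<le> norm \<xi>" by (rule Schwarz_Lemma(1)[OF g lt \<xi>])
  assume \<xi>0: "\<xi> \<noteq> 0" "g \<xi> = \<xi>" "norm \<zeta> < 1"
  then obtain \<alpha> where \<alpha>: "\<And>z. norm z < 1 \<Longrightarrow> g z = \<alpha> * z"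
    using Schwarz_Lemma(3)[OF g lt \<xi>] \<xi> by metis
  then have "\<alpha> = 1" using \<alpha>[OF \<xi>] \<xi>0 by simp
  then show "g \<zeta> = \<zeta>" using \<alpha> \<xi>0 by simp
qed

lemma Schwarz_Lemma_ball_norm:
  fixes f :: "complex ^ 'n \<Rightarrow> complex ^ 'm"
  assumes hol: "\<And>i. holo_on (ball 0 1) (\<lambda>z. f z $ i)" and f: "f ` ball 0 1 \<subseteq> ball 0 1" and "f 0 = 0"
    and z: "norm z < 1"
  shows "norm (f z) \<le> norm z"
proof (cases "z = 0 \<or> f z = 0")
  case False
  \<comment> \<open>With \<open>u\<close> along \<open>z\<close> and \<open>v\<close> along
    \<open>f z\<close>, the slice takes the value |f z| at |z|.\<close>
  define u where "u = inverse (complex_of_real (norm z)) *s z"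
  define v where "v = inverse (complex_of_real (norm (f z))) *s f z"
  have uv: "norm u = 1" "norm v = 1"
    using False by (simp_all add: u_def v_def norm_vector_scalar norm_inverse)
  have "complex_of_real (norm z) *s u = z" using False by (simp add: u_def)
  then have "hinner (f (of_real (norm z) *s u)) v = of_real (norm (f z))"
    using False by (simp add: v_def hinner_linear hinner_self power2_eq_square)
  then show ?thesis
    using Schwarz_Lemma_ball(1)[OF hol f \<open>f 0 = 0\<close> uv, of "of_real (norm z)"] z by simp
qed (use \<open>f 0 = 0\<close> in auto)

text \<open>
  The equality case of the Schwarz lemma makes \<open>f\<close> homogeneous, so it coincides with its derivative
  at the origin.
\<close>

lemma norm_preserving_imp_unitary:
  fixes f :: "complex ^ 'n \<Rightarrow> complex ^ 'm"
  assumes hol: "\<And>i. holo_on (ball 0 1) (\<lambda>z. f z $ i)"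
    and norm: "\<And>z. norm z < 1 \<Longrightarrow> norm (f z) = norm z"
    and zw: "norm z < 1" "norm w < 1"
  shows "hinner (f z) (f w) = hinner z w"
proof -
  have f0: "f 0 = 0" using norm[of 0] by simp
  have fb: "f ` ball 0 1 \<subseteq> ball 0 1" using norm by auto
  have line: "\<exists>v. \<forall>\<zeta>. norm \<zeta> < 1 \<longrightarrow> f (\<zeta> *s u) = \<zeta> *s v" if u: "norm u = 1" for u
  proof -
    \<comment> \<open>Doubling the value at half of \<open>u\<close> gives a unit vector, and makes
      1/2 a fixed point of the slice.\<close>
    define v where "v = 2 *s f ((1 / 2) *s u)"
    have half: "norm (f ((1 / 2) *s u)) = 1 / 2"
      using u by (subst norm) (simp_all add: norm_vector_scalar)
    then have v: "norm v = 1" by (simp add: v_def norm_vector_scalar)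
    have "hinner (f ((1 / 2) *s u)) v = 1 / 2"
      by (simp add: v_def hinner_linear hinner_self half power2_eq_square)
    then have g: "hinner (f (\<zeta> *s u)) v = \<zeta>" if "norm \<zeta> < 1" for \<zeta>
      using Schwarz_Lemma_ball(2)[OF hol fb f0 u v, of "1 / 2" \<zeta>] that by simp
    have "f (\<zeta> *s u) = \<zeta> *s v" if \<zeta>: "norm \<zeta> < 1" for \<zeta>
    proof -
      let ?y = "f (\<zeta> *s u)"
      have y: "hinner ?y v = \<zeta>" "hinner v ?y = cnj \<zeta>"
        using g[OF \<zeta>] vinner_commute[of UNIV "($) v" "($) ?y"] by auto
      have "norm ?y = cmod \<zeta>" using norm[of "\<zeta> *s u"] \<zeta> u by (simp add: norm_vector_scalar)
      then have "hinner ?y ?y = \<zeta> * cnj \<zeta>" "hinner v v = 1"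
        using v by (simp_all add: hinner_self complex_norm_square del: of_real_power)
      \<comment> \<open>Equality in Cauchy-Schwarz: \<open>?y\<close> has norm |\<zeta>| and
        component \<zeta> along the unit vector \<open>v\<close>.\<close>
      then have "hinner (?y - \<zeta> *s v) (?y - \<zeta> *s v) = 0"
        by (simp add: hinner_linear y)
      then show ?thesis by (simp add: hinner_self)
    qed
    then show ?thesis by blast
  qed
  have hom: "f (\<zeta> *s x) = \<zeta> *s f x" if x: "norm x < 1" and \<zeta>: "norm \<zeta> \<le> 1" for x \<zeta>
  proof (cases "x = 0")
    case False
    define u where "u = inverse (complex_of_real (norm x)) *s x"
    have "norm u = 1" using False by (simp add: u_def norm_vector_scalar norm_inverse)
    then obtain v where v: "\<And>\<eta>. norm \<eta> < 1 \<Longrightarrow> f (\<eta> *s u) = \<eta> *s v" using line by blast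
    have xu: "x = of_real (norm x) *s u" using False by (simp add: u_def)
    have "cmod \<zeta> * norm x \<le> 1 * norm x" using \<zeta> by (intro mult_right_mono) auto
    then have "norm (\<zeta> * of_real (norm x)) < 1" using x by (simp add: norm_mult)
    from v[OF this] have "f (\<zeta> *s x) = \<zeta> *s (of_real (norm x) *s v)"
      by (simp add: vector_smult_assoc flip: xu) (subst xu, simp)
    also have "of_real (norm x) *s v = f x"
      using v[of "of_real (norm x)"] x by (simp flip: xu)
    finally show ?thesis .
  qed (simp add: f0)
  obtain D where D: "(f has_derivative D) (at 0)" "\<And>c v. D (c *s v) = c *s D v"
    using holo_on_derivative_vec[OF hol, of 0] by auto
  \<comment> \<open>By homogeneity the curve \<open>f (\<zeta> *s x)\<close> is
    \<open>\<zeta> *s f x\<close> near 0; comparing this with the chain rule gives the claim at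
    \<zeta> = 1.\<close>
  have fD: "f x = D x" if x: "norm x < 1" for x
  proof -
    have "((\<lambda>\<zeta>. \<zeta> *s x) has_derivative (\<lambda>\<zeta>. \<zeta> *s x)) (at 0)"
      by (rule bounded_linear_imp_has_derivative[OF bounded_linear_vector_scalar])
    from has_derivative_compose[OF this, of f D] D(1)
    have 1: "((\<lambda>\<zeta>. f (\<zeta> *s x)) has_derivative (\<lambda>\<zeta>. D (\<zeta> *s x))) (at 0)" by simp
    have "((\<lambda>\<zeta>. \<zeta> *s f x) has_derivative (\<lambda>\<zeta>. \<zeta> *s f x)) (at 0)"
      by (rule bounded_linear_imp_has_derivative[OF bounded_linear_vector_scalar])
    then have "((\<lambda>\<zeta>. f (\<zeta> *s x)) has_derivative (\<lambda>\<zeta>. \<zeta> *s f x)) (at 0)"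
      by (rule has_derivative_transform_within_open[of _ _ _ _ "ball 0 1"]) (auto simp: hom[OF x])
    with 1 have "(\<lambda>\<zeta>. D (\<zeta> *s x)) = (\<lambda>\<zeta>. \<zeta> *s f x)" by (rule has_derivative_unique)
    from fun_cong[OF this, of 1] show ?thesis by simp
  qed
  have normD: "norm (D x) = norm x" for x
  proof -
    \<comment> \<open>Scaling into the ball carries norm preservation from \<open>f\<close> to
      \<open>D\<close> on the whole space, as polarization with arbitrary \<open>c\<close>
      requires.\<close>
    define r where "r = complex_of_real (1 / (1 + norm x))"
    have r: "cmod r = 1 / (1 + norm x)" unfolding r_def norm_of_real by simp
    have "0 < 1 + norm x" by (simp add: add_pos_nonneg)
    then have rx: "norm (r *s x) < 1" by (simp add: norm_vector_scalar r)
    have "cmod r * norm (D x) = norm (f (r *s x))"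
      by (simp add: fD[OF rx] D(2) norm_vector_scalar)
    also have "\<dots> = cmod r * norm x" by (simp add: norm[OF rx] norm_vector_scalar)
    finally show ?thesis using r \<open>0 < 1 + norm x\<close> by simp
  qed
  have "hinner (D z) (D w) = hinner z w"
  proof (rule complex_polarization)
    fix c
    have add: "D (z + c *s w) = D z + c *s D w"
      using linear_add[OF has_derivative_linear[OF D(1)]] D(2) by simp
    have self: "hinner (D x) (D x) = hinner x x" for x by (simp add: hinner_self normD)
    have "hinner (D (z + c *s w)) (D (z + c *s w)) = hinner (z + c *s w) (z + c *s w)" by (rule self)
    then show "cnj c * hinner (D z) (D w) + c * hinner (D w) (D z) = cnj c * hinner z w + c * hinner w z"
      by (simp add: add hinner_linear self[of z] self[of w] algebra_simps)
  qed
  then show ?thesis using fD zw by simp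
qed

subsection \<open>The homotopy along a Whitney sequence\<close>

lemma gram_homotopic_automorphism:
  fixes \<phi> :: "complex ^ 'n \<Rightarrow> complex ^ 'n"
  assumes \<phi>: "ball_automorphism \<phi>" and M: "CARD('n) \<le> M"
  shows "gram_homotopic M (\<lambda>z w. hinner (\<phi> z) (\<phi> w)) hinner"
proof -
  have bij: "bij_betw \<phi> (ball 0 1) (ball 0 1)" using \<phi> by (simp add: ball_automorphism_def)
  let ?\<phi>' = "the_inv_into (ball 0 1) \<phi>"
  define a where "a = \<phi> 0"
  have a: "norm a < 1" using bij_betwE[OF bij] by (simp add: a_def)
  \<comment> \<open>Both \<open>\<psi>\<close> and its inverse \<open>\<psi>'\<close> fix 0, so the
    Schwarz lemma bounds both and \<open>\<psi>\<close> preserves norms.\<close>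
  define \<psi> where "\<psi> = (\<lambda>z. ball_involution a (\<phi> z))"
  define \<psi>' where "\<psi>' = (\<lambda>z. ?\<phi>' (ball_involution a z))"
  have \<phi>b: "norm (\<phi> z) < 1" if "norm z < 1" for z
    using bij_betwE[OF bij] that by simp
  have \<phi>'b: "norm (?\<phi>' z) < 1" if "norm z < 1" for z
    using bij_betwE[OF bij_betw_the_inv_into[OF bij]] that by simp
  have \<phi>'\<phi>: "?\<phi>' (\<phi> z) = z" if "norm z < 1" for z
    using bij that by (simp add: bij_betw_def the_inv_into_f_f)
  have \<psi>_hol: "holo_on (ball 0 1) (\<lambda>z. \<psi> z $ i)" for i
    unfolding \<psi>_def
  proof (rule holo_on_compose[OF _ holo_on_ball_involution[OF a]])
    show "holo_on (ball 0 1) (\<lambda>z. \<phi> z $ i)" for i using \<phi> by (simp add: ball_automorphism_def)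
  qed (use \<phi>b in auto)
  have \<psi>'_hol: "holo_on (ball 0 1) (\<lambda>z. \<psi>' z $ i)" for i
    unfolding \<psi>'_def
  proof (rule holo_on_compose[OF holo_on_ball_involution[OF a]])
    show "holo_on (ball 0 1) (\<lambda>z. ?\<phi>' z $ i)" using \<phi> by (simp add: ball_automorphism_def)
  qed (use ball_involution_norm[OF a] in auto)
  have \<psi>_le: "norm (\<psi> z) \<le> norm z" if "norm z < 1" for z
  proof (rule Schwarz_Lemma_ball_norm[OF \<psi>_hol _ _ that])
    show "\<psi> ` ball 0 1 \<subseteq> ball 0 1" using \<phi>b ball_involution_norm[OF a] by (auto simp: \<psi>_def)
    show "\<psi> 0 = 0" using ball_involution_self[OF a] by (simp add: \<psi>_def a_def)
  qed
  have "?\<phi>' a = 0" using \<phi>'\<phi>[of 0] by (simp add: a_def)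
  have \<psi>'_le: "norm (\<psi>' z) \<le> norm z" if "norm z < 1" for z
  proof (rule Schwarz_Lemma_ball_norm[OF \<psi>'_hol _ _ that])
    show "\<psi>' ` ball 0 1 \<subseteq> ball 0 1" using \<phi>'b ball_involution_norm[OF a] by (auto simp: \<psi>'_def)
    show "\<psi>' 0 = 0" using \<open>?\<phi>' a = 0\<close> by (simp add: \<psi>'_def ball_involution_0)
  qed
  have \<psi>_norm: "norm (\<psi> z) = norm z" if "norm z < 1" for z
  proof (rule antisym[OF \<psi>_le[OF that]])
    have "\<psi>' (\<psi> z) = z"
      by (simp add: \<psi>_def \<psi>'_def ball_involution_involutive a \<phi>b \<phi>'\<phi> that)
    then show "norm z \<le> norm (\<psi> z)"
      using \<psi>'_le[of "\<psi> z"] \<psi>_le[OF that] that by simp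
  qed
  define sc where "sc = (\<lambda>t::real. complex_of_real (1 - t) *s a)"
  have sc: "norm (sc t) < 1" if "t \<in> {0..1}" for t
  proof -
    have "norm (sc t) = (1 - t) * norm a"
      unfolding sc_def norm_vector_scalar norm_of_real using that by simp
    also have "\<dots> \<le> 1 * norm a" using that by (intro mult_right_mono) auto
    finally show ?thesis using a by simp
  qed
  \<comment> \<open>At t = 0 the involution cancels the one in \<open>\<psi>\<close> and returns
    \<open>\<phi>\<close>; at t = 1 it leaves \<open>- \<psi> z\<close>.\<close>
  define H where "H = (\<lambda>z t. ball_involution (sc t) (\<psi> z))"
  show ?thesis
  proof (rule gram_homotopicI[where H = "\<lambda>z t. ($) (H z t)" and I = UNIV])
    fix t :: real assume t: "t \<in> {0..1}"
    have P: "proper_on UNIV (\<lambda>z. ($) (ball_involution (sc t) z))"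
      by (intro ball_automorphism_proper ball_involution_automorphism sc t)
    have "holo_on (ball 0 1) (\<lambda>z. H z t $ i)" for i
      unfolding H_def
      by (rule holo_on_compose[OF \<psi>_hol holo_on_ball_involution[OF sc[OF t]]]) (use \<psi>_norm in auto)
    moreover have "(vnorm UNIV (($) (H z t)))\<^sup>2 < 1" if "z \<in> ball 0 1" for z
      using P \<psi>_norm that by (auto simp: proper_on_def H_def)
    moreover have "\<exists>r<1. \<forall>z\<in>ball 0 1. r < norm z \<longrightarrow> 1 - e < (vnorm UNIV (($) (H z t)))\<^sup>2"
      if "e > 0" for e
    proof -
      obtain r where r: "r < 1" "\<And>z. z \<in> ball 0 1 \<Longrightarrow> r < norm z \<Longrightarrow>
          1 - e < (vnorm UNIV (($) (ball_involution (sc t) z)))\<^sup>2"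
        using proper_on_properD[OF P \<open>e > 0\<close>] by blast
      then show ?thesis
        using \<psi>_norm by (intro exI[of _ r]) (auto simp: H_def)
    qed
    ultimately show "proper_on UNIV (\<lambda>z. ($) (H z t))" by (simp add: proper_on_def)
  next
    fix i :: 'n
    let ?S = "ball (0 :: complex ^ 'n) 1 \<times> {0..1::real}"
    have \<psi>_cont: "continuous_on ?S (\<lambda>p. \<psi> (fst p) $ j)" for j
      by (rule continuous_on_compose2[OF holo_on_imp_continuous_on[OF \<psi>_hol]])
        (auto intro: continuous_intros)
    have a_cont: "continuous_on ?S (\<lambda>p. sc (snd p) $ j)" for j
      unfolding sc_def vector_smult_component by (intro continuous_intros)
    then have sc_cont: "continuous_on ?S (\<lambda>p. sc (snd p))"
      using continuous_on_vec_lambda[of ?S "\<lambda>j p. sc (snd p) $ j"] by simp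
    have d_cont: "continuous_on ?S (\<lambda>p. defect (sc (snd p)))"
      unfolding defect_def by (intro continuous_intros sc_cont)
    have nz: "1 - (\<Sum>j\<in>UNIV. \<psi> (fst p) $ j * cnj (sc (snd p) $ j)) \<noteq> 0" if "p \<in> ?S" for p
    proof -
      have "norm (sc (snd p)) < 1" "norm (\<psi> (fst p)) < 1" using that sc \<psi>_norm by auto
      from ball_involution_denominator[OF this] show ?thesis by (simp add: vinner_def)
    qed
    have nz': "1 + defect (sc (snd p)) \<noteq> 0" if "p \<in> ?S" for p
      using that by (intro defect_nonzero sc) auto
    show "continuous_on ?S (\<lambda>p. H (fst p) (snd p) $ i)"
      unfolding H_def ball_involution_component
    proof (intro continuous_on_mult continuous_on_diff continuous_on_const \<psi>_cont a_cont d_cont)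
      have sum: "continuous_on ?S (\<lambda>p. \<Sum>j\<in>UNIV. \<psi> (fst p) $ j * cnj (sc (snd p) $ j))"
        by (intro continuous_on_sum continuous_on_mult continuous_on_cnj \<psi>_cont a_cont)
      then show "continuous_on ?S (\<lambda>p. inverse (1 - (\<Sum>j\<in>UNIV. \<psi> (fst p) $ j * cnj (sc (snd p) $ j))))"
        by (intro continuous_on_inverse continuous_on_diff continuous_on_const ballI nz)
      have "continuous_on ?S (\<lambda>p. 1 + defect (sc (snd p)))"
        by (intro continuous_on_add continuous_on_const d_cont)
      with sum show "continuous_on ?S (\<lambda>p. (\<Sum>j\<in>UNIV. \<psi> (fst p) $ j * cnj (sc (snd p) $ j)) /
          (1 + defect (sc (snd p))))"
        by (intro continuous_on_divide ballI nz')
    qed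
  next
    fix z w :: "complex ^ 'n" assume zw: "z \<in> ball 0 1" "w \<in> ball 0 1"
    have "sc 0 = a" "sc 1 = 0" by (simp_all add: sc_def)
    then show "hinner (H z 0) (H w 0) = hinner (\<phi> z) (\<phi> w)"
      using zw a \<phi>b by (simp add: H_def \<psi>_def ball_involution_involutive)
    show "hinner (H z 1) (H w 1) = hinner z w"
      using norm_preserving_imp_unitary[OF \<psi>_hol \<psi>_norm] zw \<open>sc 1 = 0\<close>
      by (simp add: H_def ball_involution_of_0 hinner_linear)
  qed (use M in auto)
qed

section \<open>A single Whitney step\<close>

lemma sum_over_Plus:
  fixes g :: "'a \<times> 'n::finite + 'a \<Rightarrow> 'c::comm_monoid_add"
  assumes "finite S" "finite T"
  shows "(\<Sum>q\<in>(S \<times> UNIV) <+> T. g q) = (\<Sum>s\<in>S. \<Sum>l\<in>UNIV. g (Inl (s, l))) + (\<Sum>t\<in>T. g (Inr t))"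
  using assms by (simp add: sum.Plus sum.cartesian_product)

lemma whitney_space_subspace:
  "cvec.subspace {dsum T w | T w. T \<in> tensor_space A \<and> w \<in> orth_compl N A}" (is "cvec.subspace ?W")
proof (rule cvec.subspaceI)
  have T: "cvec.subspace (tensor_space A)" unfolding tensor_space_def by (rule cvec.subspace_span)
  note O = orth_compl_subspace[of N A]
  have "dsum 0 0 = (0 :: nat \<times> 'a + nat \<Rightarrow> complex)"
    by (auto simp: dsum_def fun_eq_iff split: sum.splits)
  then show "0 \<in> ?W" using cvec.subspace_0[OF T] cvec.subspace_0[OF O] by force
  show "x + y \<in> ?W" if xy: "x \<in> ?W" "y \<in> ?W" for x y
  proof -
    obtain u v u' v' where "x = dsum u v" "y = dsum u' v'" "u \<in> tensor_space A" "u' \<in> tensor_space A"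
      "v \<in> orth_compl N A" "v' \<in> orth_compl N A" using xy by blast
    moreover have "dsum u v + dsum u' v' = dsum (u + u') (v + v')"
      by (auto simp: dsum_def fun_eq_iff split: sum.splits)
    ultimately show ?thesis using cvec.subspace_add[OF T] cvec.subspace_add[OF O] by blast
  qed
  show "vscale c x \<in> ?W" if x: "x \<in> ?W" for c x
  proof -
    obtain u v where "x = dsum u v" "u \<in> tensor_space A" "v \<in> orth_compl N A" using x by blast
    moreover have "vscale c (dsum u v) = dsum (vscale c u) (vscale c v)"
      by (auto simp: dsum_def vscale_def fun_eq_iff split: sum.splits)
    ultimately show ?thesis using cvec.subspace_scale[OF T] cvec.subspace_scale[OF O] by blast
  qed
qed

text \<open>
  Orthonormal bases \<open>S\<close> of \<open>A\<close> and \<open>T\<close> of its complement turn the step into: multiply the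
  coordinates of \<open>F\<close> along \<open>S\<close> by \<open>\<phi>\<close>.  The isometry \<open>j\<close> only enters through the orthonormal
  system of images of the induced basis, whose size bounds \<open>N'\<close> from below.
\<close>

lemma whitney_step_gram_homotopic:
  fixes F :: "complex ^ 'n \<Rightarrow> nat \<Rightarrow> complex"
  assumes step: "whitney_step N F N' F'" and F: "proper_holo N F"
  shows "N \<le> N'" "proper_holo N' F'"
    "gram_homotopic (N' + 1) (\<lambda>z w. vinner {..<N'} (F' z) (F' w)) (\<lambda>z w. vinner {..<N} (F z) (F w))"
proof -
  obtain A \<pi> \<phi> j where A: "A \<subseteq> vecs {..<N}" "cvec.subspace A" and \<pi>: "is_orth_proj N A \<pi>"
    and \<phi>: "ball_automorphism \<phi>"
    and j: "linear_isometry_on {dsum T w | T w. T \<in> tensor_space A \<and> w \<in> orth_compl N A}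
          (({..<N} \<times> (UNIV :: 'n set)) <+> {..<N}) {..<N'} j"
    and F': "\<And>z. z \<in> ball 0 1 \<Longrightarrow> F' z = j (dsum (tensor (\<pi> (F z)) (\<phi> z)) (F z - \<pi> (F z)))"
    using step unfolding whitney_step_def by blast
  define W where "W = {dsum T w | T w. T \<in> (tensor_space A :: (nat \<times> 'n \<Rightarrow> complex) set) \<and> w \<in> orth_compl N A}"
  have W: "cvec.subspace W" unfolding W_def by (rule whitney_space_subspace)
  note j = j[folded W_def]
  have Fv: "F z \<in> vecs {..<N}" if "z \<in> ball 0 1" for z using F that by (simp add: proper_holo_iff)
  obtain S T where ST: "finite S" "finite T" "S \<subseteq> A" "T \<subseteq> orth_compl N A" "S \<inter> T = {}"
    and on: "orthonormal_on {..<N} (S \<union> T) (\<lambda>b. b)" and card: "card S + card T = N"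
    and pS: "\<And>x. x \<in> vecs {..<N} \<Longrightarrow> \<pi> x = (\<Sum>s\<in>S. vscale (vinner {..<N} x s) s)"
    and pT: "\<And>x. x \<in> vecs {..<N} \<Longrightarrow> x - \<pi> x = (\<Sum>t\<in>T. vscale (vinner {..<N} x t) t)"
    by (rule orth_proj_bases[OF A \<pi>]) (rule that)
  define B where "B = S \<union> T"
  have B: "finite B" "S \<subseteq> B" "B - S = T" using ST by (auto simp: B_def)
  define f where "f = (\<lambda>z b. vinner {..<N} (F z) b)"
  have F_eq: "F z = (\<Sum>b\<in>B. vscale (f z b) b)" if "z \<in> ball 0 1" for z
  proof -
    have "F z = \<pi> (F z) + (F z - \<pi> (F z))" by simp
    then show ?thesis
      unfolding pT[OF Fv[OF that]] unfolding pS[OF Fv[OF that]]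
      using ST by (simp only: B_def f_def sum.union_disjoint)
  qed
  have f_gram: "vinner B (f z) (f w) = vinner {..<N} (F z) (F w)"
    if "z \<in> ball 0 1" "w \<in> ball 0 1" for z w
    using vinner_orthonormal_sum[OF on[folded B_def] B(1), of "f z" "f w"]
    by (simp only: F_eq[OF that(1), symmetric] F_eq[OF that(2), symmetric])
  have f: "proper_on B f"
  proof (rule proper_on_cong_norm)
    show "proper_on {..<N} F" using F by (simp add: proper_holo_iff)
    show "holo_on (ball 0 1) (\<lambda>z. f z b)" for b
      unfolding f_def vinner_def using F by (intro holo_on_intros) (simp add: proper_holo_def)
    show "(vnorm B (f z))\<^sup>2 = (vnorm {..<N} (F z))\<^sup>2" if "z \<in> ball 0 1" for z
      using f_gram[OF that that] unfolding vinner_self of_real_eq_iff .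
  qed
  have \<phi>_proper: "proper_on UNIV (\<lambda>z. ($) (\<phi> z))" by (rule ball_automorphism_proper[OF \<phi>])

  \<comment> \<open>\<open>e\<close> is the orthonormal system in \<open>W\<close> formed by the
    tensors of \<open>S\<close> with the standard basis and by \<open>T\<close>; \<open>h\<close>
    lists the coordinates of the tensored map along it.\<close>
  define Q :: "((nat \<Rightarrow> complex) \<times> 'n + (nat \<Rightarrow> complex)) set" where "Q = (S \<times> UNIV) <+> T"
  define e where "e = (\<lambda>q :: (nat \<Rightarrow> complex) \<times> 'n + (nat \<Rightarrow> complex). case q of
    Inl (s, l) \<Rightarrow> dsum (tensor s (axis l 1 :: complex ^ 'n)) 0 | Inr t \<Rightarrow> dsum 0 t)"
  define h where "h = (\<lambda>z (q :: (nat \<Rightarrow> complex) \<times> 'n + (nat \<Rightarrow> complex)). case q of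
    Inl (s, l) \<Rightarrow> f z s * \<phi> z $ l | Inr t \<Rightarrow> f z t)"
  have Q: "finite Q" using ST by (simp add: Q_def)
  have eW: "e q \<in> W" if "q \<in> Q" for q
  proof (cases q)
    case (Inl p)
    moreover obtain s l where "p = (s, l)" by (cases p)
    moreover have "tensor s (axis l 1) \<in> tensor_space A" if "s \<in> S" for s and l :: 'n
      unfolding tensor_space_def using ST(3) that by (intro cvec.span_base) blast
    ultimately show ?thesis
      using that cvec.subspace_0[OF orth_compl_subspace[of N A]] by (auto simp: e_def W_def Q_def)
  next
    case (Inr t)
    have "0 \<in> (tensor_space A :: (nat \<times> 'n \<Rightarrow> complex) set)"
      unfolding tensor_space_def by (rule cvec.span_zero)
    with Inr that ST(4) show ?thesis by (auto simp: e_def W_def Q_def)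
  qed
  have "orthonormal_on (({..<N} \<times> (UNIV :: 'n set)) <+> {..<N}) Q e"
    using on ST(5) unfolding orthonormal_on_def
    by (auto simp: Q_def e_def vinner_dsum vinner_tensor hinner_axis vinner_linear)
  \<comment> \<open>This system lies in dimension \<open>N'\<close>, so its size bounds
    \<open>N'\<close> from below.\<close>
  then have on_je: "orthonormal_on {..<N'} Q (\<lambda>q. j (e q))"
    using eW by (simp add: orthonormal_on_def linear_isometry_on_vinner[OF j W])
  have "card Q = card S * CARD('n) + card T"
    using ST by (simp add: Q_def card_Plus card_cartesian_product)
  then have card': "card S * CARD('n) + card T \<le> N'"
    using card_orthonormal_le[OF on_je Q] by simp
  have "card S * 1 \<le> card S * CARD('n)" by (intro mult_le_mono2) (simp add: Suc_leI)
  then show "N \<le> N'" using card card' by linarith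
  have F'_eq: "F' z = (\<Sum>q\<in>Q. vscale (h z q) (j (e q)))" if z: "z \<in> ball 0 1" for z
  proof -
    have "dsum (tensor (\<pi> (F z)) (\<phi> z)) (F z - \<pi> (F z)) = (\<Sum>q\<in>Q. vscale (h z q) (e q))"
    proof
      fix k :: "nat \<times> 'n + nat"
      show "dsum (tensor (\<pi> (F z)) (\<phi> z)) (F z - \<pi> (F z)) k = (\<Sum>q\<in>Q. vscale (h z q) (e q)) k"
      proof (cases k)
        case (Inl p)
        obtain i l where p: "p = (i, l)" by (cases p)
        have ax: "f z s * \<phi> z $ m * (s i * axis m 1 $ l) = (if m = l then f z s * s i * \<phi> z $ l else 0)"
          for s m by (simp add: axis_def)
        have "(\<Sum>q\<in>Q. vscale (h z q) (e q)) k = (\<Sum>s\<in>S. f z s * s i * \<phi> z $ l)"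
          using ST by (simp add: Q_def sum_over_Plus sum_fun_apply vscale_def h_def e_def dsum_def
              tensor_def Inl p ax)
        also have "\<dots> = \<pi> (F z) i * \<phi> z $ l"
          unfolding pS[OF Fv[OF z]] by (simp add: sum_fun_apply vscale_def f_def sum_distrib_right)
        finally show ?thesis by (simp add: Inl p dsum_def tensor_def)
      next
        case (Inr i)
        have "(\<Sum>q\<in>Q. vscale (h z q) (e q)) k = (\<Sum>t\<in>T. f z t * t i)"
          using ST by (simp add: Q_def sum_over_Plus sum_fun_apply vscale_def h_def e_def dsum_def Inr)
        also have "\<dots> = (F z - \<pi> (F z)) i"
          unfolding pT[OF Fv[OF z]] by (simp add: sum_fun_apply vscale_def f_def)
        finally show ?thesis by (simp add: Inr dsum_def)
      qed
    qed
    then show ?thesis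
      using linear_isometry_on_sum[OF j W Q eW] by (simp only: F'[OF z])
  qed
  define K where "K = (\<lambda>z w. \<Sum>b\<in>B. f z b * cnj (f w b) * (if b \<in> S then hinner (\<phi> z) (\<phi> w) else 1))"
  have F'_gram: "vinner {..<N'} (F' z) (F' w) = K z w" if "z \<in> ball 0 1" "w \<in> ball 0 1" for z w
  proof -
    have "vinner {..<N'} (F' z) (F' w) = vinner Q (h z) (h w)"
      unfolding F'_eq[OF that(1)] F'_eq[OF that(2)] by (rule vinner_orthonormal_sum[OF on_je Q])
    also have "\<dots> = (\<Sum>s\<in>S. f z s * cnj (f w s) * hinner (\<phi> z) (\<phi> w)) + (\<Sum>t\<in>T. f z t * cnj (f w t))"
      using ST by (simp add: vinner_def Q_def sum_over_Plus h_def sum_distrib_left mult_ac)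
    also have "\<dots> = K z w"
    proof -
      have "(\<Sum>t\<in>T. f z t * cnj (f w t)) =
          (\<Sum>b\<in>T. f z b * cnj (f w b) * (if b \<in> S then hinner (\<phi> z) (\<phi> w) else 1))"
        using ST(5) by (intro sum.cong) auto
      then show ?thesis using ST by (simp add: K_def B_def sum.union_disjoint)
    qed
    finally show ?thesis .
  qed
  have "gram_homotopic (N' + 1) K (\<lambda>z w. vinner B (f z) (f w))"
    unfolding K_def using f \<phi>_proper B ST(1) card' by (intro gram_homotopic_untensor) auto
  then show "gram_homotopic (N' + 1)
      (\<lambda>z w. vinner {..<N'} (F' z) (F' w)) (\<lambda>z w. vinner {..<N} (F z) (F w))"
    by (rule gram_homotopic_cong) (simp_all add: F'_gram f_gram)
  show "proper_holo N' F'"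
    unfolding proper_holo_iff
  proof
    have "j (e q) \<in> vecs {..<N'}" if "q \<in> Q" for q
      using j eW[OF that] by (auto simp: linear_isometry_on_def)
    then show "\<forall>z\<in>ball 0 1. F' z \<in> vecs {..<N'}"
      by (auto simp: F'_eq intro!: vecs_sum vecs_closed)
    \<comment> \<open>The fully tensored map is the partial tensor for the indicator of
      \<open>S\<close>. Its norm is that of \<open>F'\<close>, which yields properness of
      \<open>F'\<close>.\<close>
    define m where "m = (\<lambda>b. if b \<in> S then 1 else 0 :: real)"
    let ?P = "\<lambda>z. partial_tensor m (f z) (\<phi> z)"
    show "proper_on {..<N'} F'"
    proof (rule proper_on_cong_norm)
      show "proper_on (B \<times> UNIV) ?P"
        by (rule proper_on_partial_tensor[OF f \<phi>_proper B(1)]) (auto simp: m_def)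
      show "(vnorm {..<N'} (F' z))\<^sup>2 = (vnorm (B \<times> UNIV) (?P z))\<^sup>2" if z: "z \<in> ball 0 1" for z
      proof -
        have "vinner (B \<times> UNIV) (?P z) (?P z) = (\<Sum>b\<in>B. f z b * cnj (f z b) *
            (of_real (m b) * hinner (\<phi> z) (\<phi> z) + of_real (1 - m b)))"
          using B(1) by (intro vinner_partial_tensor) (auto simp: m_def)
        also have "\<dots> = K z z" unfolding K_def by (intro sum.cong) (auto simp: m_def)
        also have "\<dots> = vinner {..<N'} (F' z) (F' z)" using F'_gram[OF z z] by simp
        finally show ?thesis unfolding vinner_self of_real_eq_iff by simp
      qed
      fix i
      have "holo_on (ball 0 1) (\<lambda>z. h z q)" if "q \<in> Q" for q
      proof -
        have "holo_on (ball 0 1) (\<lambda>z. f z b)" if "b \<in> B" for b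
          using f that by (simp add: proper_on_def)
        moreover have "holo_on (ball 0 1) (\<lambda>z. \<phi> z $ l)" for l
          using \<phi> by (simp add: ball_automorphism_def)
        ultimately show ?thesis
          using that by (auto simp: h_def Q_def B_def intro!: holo_on_intros)
      qed
      then have "holo_on (ball 0 1) (\<lambda>z. \<Sum>q\<in>Q. h z q * j (e q) i)"
        by (auto intro!: holo_on_intros)
      then show "holo_on (ball 0 1) (\<lambda>z. F' z i)"
        by (subst holo_on_cong[where g = "\<lambda>z. \<Sum>q\<in>Q. h z q * j (e q) i"])
          (auto simp: F'_eq sum_fun_apply vscale_def)
    qed
  qed
qed

section \<open>Larger targets and the induction along the sequence\<close>

lemma gram_homotopic_mono:
  assumes "gram_homotopic M K L" "M \<le> M'"
  shows "gram_homotopic M' K L"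
proof -
  obtain f g where fg: "proper_homotopic M f g"
      "\<And>z w. z \<in> ball 0 1 \<Longrightarrow> w \<in> ball 0 1 \<Longrightarrow> vinner {..<M} (f z) (f w) = K z w"
      "\<And>z w. z \<in> ball 0 1 \<Longrightarrow> w \<in> ball 0 1 \<Longrightarrow> vinner {..<M} (g z) (g w) = L z w"
    using assms(1) unfolding gram_homotopic_def by blast
  obtain H where H: "continuous_on (ball 0 1 \<times> {0..1}) H"
      "\<And>t::real. t\<in>{0..1} \<Longrightarrow> proper_holo M (\<lambda>z. H (z, t))"
      "\<And>z. z\<in>ball 0 1 \<Longrightarrow> H (z, 0) = f z" "\<And>z. z\<in>ball 0 1 \<Longrightarrow> H (z, 1) = g z"
    using fg(1) unfolding proper_homotopic_def by blast
  show ?thesis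
  proof (rule gram_homotopicI[where H = "\<lambda>z t. H (z, t)" and I = "{..<M}"])
    show "continuous_on (ball 0 1 \<times> {0..1}) (\<lambda>p. H (fst p, snd p) i)" for i
      using continuous_on_product_then_coordinatewise[OF H(1)] by simp
  qed (use H fg assms(2) in \<open>auto simp: proper_holo_iff\<close>)
qed

lemma coords_vecs: "coords z \<in> vecs {..<CARD('n)}" for z :: "complex ^ 'n"
  by (simp add: vecs_def coords_def)

lemma vinner_coords: "vinner {..<CARD('n)} (coords z) (coords w) = hinner z w" for z w :: "complex ^ 'n"
proof -
  have "bij_betw (from_nat_into (UNIV :: 'n set)) {..<CARD('n)} UNIV"
    using bij_betw_from_nat_into_finite[of "UNIV :: 'n set"] by simp
  from sum.reindex_bij_betw[OF this, of "\<lambda>i. z $ i * cnj (w $ i)"] show ?thesis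
    by (simp add: vinner_def coords_def)
qed

lemma proper_holo_coords:
  fixes \<phi> :: "complex ^ 'n \<Rightarrow> complex ^ 'n"
  assumes "ball_automorphism \<phi>"
  shows "proper_holo CARD('n) (\<lambda>z. coords (\<phi> z))"
  unfolding proper_holo_iff
proof
  show "proper_on {..<CARD('n)} (\<lambda>z. coords (\<phi> z))"
  proof (rule proper_on_cong_norm[OF ball_automorphism_proper[OF assms]])
    show "holo_on (ball 0 1) (\<lambda>z. coords (\<phi> z) i)" if "i \<in> {..<CARD('n)}" for i
      using assms that by (simp add: coords_def ball_automorphism_def)
    show "(vnorm {..<CARD('n)} (coords (\<phi> z)))\<^sup>2 = (vnorm UNIV (($) (\<phi> z)))\<^sup>2" for z
      using vinner_coords[of "\<phi> z" "\<phi> z"] unfolding vinner_self of_real_eq_iff .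
  qed
qed (simp add: coords_vecs)

lemma ball_automorphism_id: "ball_automorphism (\<lambda>z :: complex ^ 'n. z)"
proof -
  have "the_inv_into (ball 0 1) (\<lambda>z. z) z = z" if "z \<in> ball 0 1" for z :: "complex ^ 'n"
    using that by (intro the_inv_into_f_eq) (auto simp: inj_on_def)
  then have "holo_on (ball (0 :: complex ^ 'n) 1) (\<lambda>z. the_inv_into (ball 0 1) (\<lambda>z. z) z $ i)" for i
    by (subst holo_on_cong[where g = "\<lambda>z. z $ i"]) (simp_all add: holo_on_component)
  then show ?thesis by (auto simp: ball_automorphism_def bij_betw_def inj_on_def holo_on_component)
qed

lemma vinner_vecs_mono:
  fixes N M :: nat
  assumes "u \<in> vecs {..<N}" "N \<le> M"
  shows "vinner {..<M} u v = vinner {..<N} u v"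
  unfolding vinner_def using assms
  by (intro sum.mono_neutral_right) (auto simp: vecs_def)

lemma proper_holo_mono:
  assumes "proper_holo N f" "N \<le> M"
  shows "proper_holo M f"
proof -
  have v: "f z \<in> vecs {..<N}" if "z \<in> ball 0 1" for z using assms(1) that by (simp add: proper_holo_iff)
  have "proper_on {..<M} f"
  proof (rule proper_on_cong_norm)
    show "proper_on {..<N} f" using assms(1) by (simp add: proper_holo_iff)
    show "(vnorm {..<M} (f z))\<^sup>2 = (vnorm {..<N} (f z))\<^sup>2" if "z \<in> ball 0 1" for z
      using vinner_vecs_mono[OF v[OF that] assms(2), of "f z"] unfolding vinner_self of_real_eq_iff .
    show "holo_on (ball 0 1) (\<lambda>z. f z i)" for i
    proof (cases "i < N")
      case False
      then have "f z i = 0" if "z \<in> ball 0 1" for z using v[OF that] by (auto simp: vecs_def)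
      then show ?thesis
        using holo_on_const[of _ 0] by (subst holo_on_cong[where g = "\<lambda>z. 0"]) auto
    qed (use assms(1) in \<open>simp add: proper_holo_def\<close>)
  qed
  with v assms(2) show ?thesis by (fastforce simp: proper_holo_iff vecs_def)
qed

text \<open>Induction on \<open>k\<close>: the homotopy already found in dimension
  \<open>N k + 1\<close> is padded to \<open>N (Suc k) + 1\<close> and preceded by the one that
  undoes the last step. Properness is carried along because each step needs it of its
  predecessor.\<close>

lemma whitney_sequence_gram_homotopic:
  fixes F :: "nat \<Rightarrow> complex ^ 'n \<Rightarrow> nat \<Rightarrow> complex"
  assumes "whitney_sequence N F"
  shows "CARD('n) \<le> N k \<and> proper_holo (N k) (F k) \<and>
    gram_homotopic (N k + 1) (\<lambda>z w. vinner {..<N k} (F k z) (F k w)) hinner"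
proof (induction k)
  case 0
  obtain \<phi> where \<phi>: "ball_automorphism \<phi>" "\<And>z. z \<in> ball 0 1 \<Longrightarrow> F 0 z = coords (\<phi> z)"
    and N0: "N 0 = CARD('n)"
    using assms unfolding whitney_sequence_def by blast
  have "gram_homotopic (CARD('n) + 1) (\<lambda>z w. hinner (\<phi> z) (\<phi> w)) hinner"
    by (rule gram_homotopic_automorphism[OF \<phi>(1)]) simp
  then have "gram_homotopic (N 0 + 1) (\<lambda>z w. vinner {..<N 0} (F 0 z) (F 0 w)) hinner"
    unfolding N0 by (rule gram_homotopic_cong) (simp_all add: \<phi>(2) vinner_coords)
  moreover have "proper_holo (N 0) (F 0)"
    unfolding N0 by (rule proper_holo_cong[OF proper_holo_coords[OF \<phi>(1)] \<phi>(2)])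
  ultimately show ?case by (simp add: N0)
next
  case (Suc k)
  have step: "whitney_step (N k) (F k) (N (Suc k)) (F (Suc k))"
    using assms by (simp add: whitney_sequence_def)
  note * = whitney_step_gram_homotopic[OF step]
  have "gram_homotopic (N (Suc k) + 1) (\<lambda>z w. vinner {..<N k} (F k z) (F k w)) hinner"
    by (rule gram_homotopic_mono[of "N k + 1"]) (use Suc *(1) in auto)
  with *(3) Suc have "gram_homotopic (N (Suc k) + 1)
      (\<lambda>z w. vinner {..<N (Suc k)} (F (Suc k) z) (F (Suc k) w)) hinner"
    using gram_homotopic_trans by fast
  with Suc *(1,2) show ?case by simp
qed

theorem theorem5p2:
  fixes N :: "nat \<Rightarrow> nat"
    and F :: "nat \<Rightarrow> complex ^ 'n \<Rightarrow> nat \<Rightarrow> complex"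
    and k :: nat
  assumes "whitney_sequence N F"
  shows "homotopic_in_dim (N k + 1)
           (N k + 1) (\<lambda>z. pad (N k) (F k z))
           (N k + 1) (\<lambda>z. pad CARD('n) (coords z))"
proof -
  define M where "M = N k + 1"
  have n: "CARD('n) \<le> M" and F: "proper_holo (N k) (F k)"
    and hom: "gram_homotopic M (\<lambda>z w. vinner {..<N k} (F k z) (F k w)) hinner"
    using whitney_sequence_gram_homotopic[OF assms, of k] by (auto simp: M_def)
  have Fv: "F k z \<in> vecs {..<N k}" if "z \<in> ball 0 1" for z
    using F that by (simp add: proper_holo_iff)
  have padF: "pad (N k) (F k z) = F k z" "pad M (F k z) = F k z" if "z \<in> ball 0 1" for z
    using Fv[OF that] by (auto simp: pad_def vecs_def fun_eq_iff M_def)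
  have padc: "pad CARD('n) (coords z) = coords z" "pad M (coords z) = coords z" for z :: "complex ^ 'n"
    using n by (auto simp: pad_def coords_def fun_eq_iff)
  have norm_F: "(vnorm {..<M} (F k z))\<^sup>2 = (vnorm {..<N k} (F k z))\<^sup>2" if "z \<in> ball 0 1" for z
    using vinner_vecs_mono[OF Fv[OF that], of M "F k z"] unfolding vinner_self of_real_eq_iff
    by (simp add: M_def)
  have "vinner {..<M} (coords z) (coords z) = hinner z z" for z :: "complex ^ 'n"
    using vinner_vecs_mono[OF coords_vecs n] by (simp add: vinner_coords)
  then have norm_coords: "(vnorm {..<M} (coords z))\<^sup>2 = (vnorm UNIV (($) z))\<^sup>2" for z :: "complex ^ 'n"
    unfolding vinner_self of_real_eq_iff .
  \<comment> \<open>\<open>f\<close> and \<open>g\<close> need not be the padded maps; putting w = z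
    in the kernels gives the norm equivalence required at the ends.\<close>
  obtain f g where fg: "proper_homotopic M f g"
      "\<And>z w. z \<in> ball 0 1 \<Longrightarrow> w \<in> ball 0 1 \<Longrightarrow> vinner {..<M} (f z) (f w) = vinner {..<N k} (F k z) (F k w)"
      "\<And>z w. z \<in> ball 0 1 \<Longrightarrow> w \<in> ball 0 1 \<Longrightarrow> vinner {..<M} (g z) (g w) = hinner z w"
    using hom unfolding gram_homotopic_def by blast
  have norms: "(vnorm {..<M} (f z))\<^sup>2 = (vnorm {..<M} (F k z))\<^sup>2"
    "(vnorm {..<M} (g z))\<^sup>2 = (vnorm {..<M} (coords z))\<^sup>2" if "z \<in> ball 0 1" for z
    using fg(2)[OF that that] fg(3)[OF that that] norm_F[OF that] norm_coords[of z]
    unfolding vinner_self of_real_eq_iff by simp_all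
  have proper_F: "proper_holo M (\<lambda>z. pad (N k) (F k z))"
    using proper_holo_mono[OF F, of M]
    by (rule proper_holo_cong) (simp_all add: M_def padF)
  have proper_c: "proper_holo M (\<lambda>z :: complex ^ 'n. pad CARD('n) (coords z))"
    using proper_holo_mono[OF proper_holo_coords[OF ball_automorphism_id] n] by (simp add: padc)
  obtain H where H: "continuous_on (ball 0 1 \<times> {0..1}) H"
      "\<And>t::real. t\<in>{0..1} \<Longrightarrow> proper_holo M (\<lambda>z. H (z, t))"
      "\<And>z. z\<in>ball 0 1 \<Longrightarrow> H (z, 0) = f z" "\<And>z. z\<in>ball 0 1 \<Longrightarrow> H (z, 1) = g z"
    using fg(1) unfolding proper_homotopic_def by blast
  have "norm_equiv M (\<lambda>z. H (z, 0)) (\<lambda>z. pad M (pad (N k) (F k z)))"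
    "norm_equiv M (\<lambda>z. H (z, 1)) (\<lambda>z. pad M (pad CARD('n) (coords z)))"
    by (simp_all add: norm_equiv_def H padF padc norms)
  then show ?thesis
    unfolding homotopic_in_dim_def M_def[symmetric]
    using proper_F proper_c H(1,2) by blast
qed

end
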